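(* Let $\boldsymbol a=(a_1,\dots,a_m)\in\mathbb{Z}_{>0}^m$ with $a_i\geq2$ for all $i\in[m]$ and $d:=\sum_{i=1}^m a_i\geq3$. Let $\Delta$ be an $\boldsymbol a$-balanced minimal $(d-1)$-cycle complex with an $\boldsymbol a$-coloring $\kappa$. Then $G(\Delta)$ is $(\kappa,\boldsymbol a)$-sparse rigid.
   Context: Simplicial complexes are finite; $[m]=\{1,\dots,m\}$. $V(\Delta)$ is the vertex set and $G(\Delta)$ the graph (1-skeleton) of $\Delta$. For a collection $\mathcal S$ of finite sets, $\langle\mathcal S\rangle=\{G: G\subseteq F \text{ for some } F\in\mathcal S\}$. Minimal cycle complexes. Let $\Gamma$ be an abelian group. On a totally ordered vertex set, an $i$-chain is a formal sum $c=\sum_F a_F F$ of $i$-faces with $a_F\in\Gamma$; $\partial c=\sum_F a_F\,\partial F$, where for $F=\{x_1<\dots<x_{i+1}\}$, $\partial F=\sum_{j=1}^{i+1}(-1)^jF\setminus\{x_j\}$. An $i$-cycle is an $i$-chain $c$ with $\partial c=0$. A chain $c'=\sum b_FF$ is a subchain of $c=\sum a_FF$ if $b_F\in\{0,a_F\}$ for every $F$. An $i$-cycle $c$ is minimal if its only subchains that are $i$-cycles are $c$ and $0$. $\operatorname{supp} c=\{F:a_F\neq0\}$. A $(d-1)$-dimensional simplicial complex $\Delta$ is a minimal $(d-1)$-cycle complex (over $\Gamma$) if either (i) $\Delta=\langle\{F\}\rangle$ for a $d$-set $F$, or (ii) $\Delta=\langle\operatorname{supp}c\rangle$ for some nonzero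 minimal $(d-1)$-cycle $c$ with coefficients in $\Gamma$. Here $\Gamma$ is an arbitrary abelian group. For $\boldsymbol a\in\mathbb{Z}_{>0}^m$ with $\sum_i a_i=d$, a $(d-1)$-dimensional complex $\Delta$ is $\boldsymbol a$-balanced if there is a map $\kappa:V(\Delta)\to[m]$, called an $\boldsymbol a$-coloring, with $|F\cap\kappa^{-1}(i)|\leq a_i$ for all $F\in\Delta$ and $i\in[m]$. Rigidity. A framework $(G,p)$ in $\mathbb{R}^d$ is a finite simple graph $G$ with a map (point configuration) $p:V(G)\to\mathbb{R}^d$. An infinitesimal motion is a map $\dot p:V(G)\to\mathbb{R}^d$ with $(p(i)-p(j))\cdot(\dot p(i)-\dot p(j))=0$ for all $ij\in E(G)$; it is trivial if $\dot p(i)=Sp(i)+t$ for all $i$, for some skew-symmetric $S$ and some $t\in\mathbb{R}^d$. $(G,p)$ is infinitesimally rigid if all its infinitesimal motions are trivial. Sparse rigidity. Write $\mathbb{R}^d=\prod_{i=1}^m\mathbb{R}^{a_i}$ and $H_i=\{(x_1,\dots,x_m): x_j=0 \text{ for } j\neq i\}$, where $x_j\in\mathbb{R}^{a_j}$. For a graph $G$ and $\kappa:V(G)\to[m]$, a point configuration $p:V(G)\to\mathbb{R}^d$ is $(\kappa,\boldsymbol a)$-sparse if $p(v)\in H_{\kappa(v)}$ for all $v\in V(G)$. $G$ is $(\kappa,\boldsymbol a)$-sparse rigid if $(G,p)$ is infinitesimally rigid in $\mathbb{R}^d$ for some $(\kappa,\boldsymbol a)$-sparse $p$. *)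

theory Defs
  imports "HOL-Library.Poly_Mapping" "Jordan_Normal_Form.Matrix"
begin

section \<open>Simplicial complexes\<close>

definition simplicial_complex :: "'v set set \<Rightarrow> bool" where
  "simplicial_complex \<Delta> \<longleftrightarrow>
     finite \<Delta> \<and> (\<forall>F\<in>\<Delta>. finite F) \<and> (\<forall>F\<in>\<Delta>. \<forall>G. G \<subseteq> F \<longrightarrow> G \<in> \<Delta>)"

definition complex_of_dim :: "nat \<Rightarrow> 'v set set \<Rightarrow> bool" where
  "complex_of_dim i \<Delta> \<longleftrightarrow>
     simplicial_complex \<Delta> \<and> (\<forall>F\<in>\<Delta>. card F \<le> Suc i) \<and> (\<exists>F\<in>\<Delta>. card F = Suc i)"

definition generated :: "'v set set \<Rightarrow> 'v set set" where
  "generated \<S> = {G. \<exists>F\<in>\<S>. G \<subseteq> F}"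

definition vertices :: "'v set set \<Rightarrow> 'v set" where
  "vertices \<Delta> = {v. {v} \<in> \<Delta>}"


section \<open>Chains and minimal cycle complexes\<close>

text \<open>A formal sum of faces is a finitely supported function on finite sets;
  its support is \<^term>\<open>Poly_Mapping.keys\<close>. An \<open>i\<close>-face has \<open>i + 1\<close> vertices.\<close>

definition chain :: "nat \<Rightarrow> ('v set \<Rightarrow>\<^sub>0 'g::ab_group_add) \<Rightarrow> bool" where
  "chain i c \<longleftrightarrow> (\<forall>F\<in>Poly_Mapping.keys c. card F = Suc i)"

text \<open>The vertex \<open>x\<close> of \<open>F = {x\<^sub>1 < \<dots> < x\<^sub>k}\<close> is \<open>x\<^sub>j\<close> for \<open>j = card {y \<in> F. y \<le> x}\<close>; the
  conditional below is multiplication by the sign \<open>(-1)\<close> to the power \<open>j\<close>, which is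
  available in every abelian group.\<close>

definition boundary ::
  "('v::linorder set \<Rightarrow>\<^sub>0 'g::ab_group_add) \<Rightarrow> ('v set \<Rightarrow>\<^sub>0 'g)" where
  "boundary c =
     (\<Sum>F\<in>Poly_Mapping.keys c. \<Sum>x\<in>F.
        Poly_Mapping.single (F - {x})
          (if even (card {y\<in>F. y \<le> x}) then Poly_Mapping.lookup c F
           else - Poly_Mapping.lookup c F))"

definition cycle :: "nat \<Rightarrow> ('v::linorder set \<Rightarrow>\<^sub>0 'g::ab_group_add) \<Rightarrow> bool" where
  "cycle i c \<longleftrightarrow> chain i c \<and> boundary c = 0"

definition subchain :: "('v set \<Rightarrow>\<^sub>0 'g::ab_group_add) \<Rightarrow> ('v set \<Rightarrow>\<^sub>0 'g) \<Rightarrow> bool" where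
  "subchain c' c \<longleftrightarrow>
     (\<forall>F. Poly_Mapping.lookup c' F \<in> {0, Poly_Mapping.lookup c F})"

definition minimal_cycle :: "nat \<Rightarrow> ('v::linorder set \<Rightarrow>\<^sub>0 'g::ab_group_add) \<Rightarrow> bool" where
  "minimal_cycle i c \<longleftrightarrow>
     cycle i c \<and> (\<forall>c'. subchain c' c \<and> cycle i c' \<longrightarrow> c' = c \<or> c' = 0)"

text \<open>The coefficient group is the type \<open>'g\<close>, passed as a type argument because it does not
  occur in the type of the complex.\<close>

definition minimal_cycle_complex ::
  "'g::ab_group_add itself \<Rightarrow> nat \<Rightarrow> 'v::linorder set set \<Rightarrow> bool" where
  "minimal_cycle_complex _ i \<Delta> \<longleftrightarrow>
     complex_of_dim i \<Delta> \<and>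
     ((\<exists>F. finite F \<and> card F = Suc i \<and> \<Delta> = generated {F}) \<or>
      (\<exists>c :: 'v set \<Rightarrow>\<^sub>0 'g. c \<noteq> 0 \<and> minimal_cycle i c \<and>
         \<Delta> = generated (Poly_Mapping.keys c)))"


section \<open>Balanced complexes\<close>

text \<open>A vector \<open>(a\<^sub>1, \<dots>, a\<^sub>m)\<close> is given by \<open>m\<close> and a function \<open>a\<close> of which only the values on
  \<open>{1..m}\<close> matter.\<close>

definition coloring :: "nat \<Rightarrow> (nat \<Rightarrow> nat) \<Rightarrow> 'v set set \<Rightarrow> ('v \<Rightarrow> nat) \<Rightarrow> bool" where
  "coloring m a \<Delta> \<kappa> \<longleftrightarrow>
     \<kappa> ` vertices \<Delta> \<subseteq> {1..m} \<and>
     (\<forall>F\<in>\<Delta>. \<forall>i\<in>{1..m}. card (F \<inter> \<kappa> -` {i}) \<le> a i)"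

definition balanced :: "nat \<Rightarrow> (nat \<Rightarrow> nat) \<Rightarrow> 'v set set \<Rightarrow> bool" where
  "balanced m a \<Delta> \<longleftrightarrow>
     (\<forall>i\<in>{1..m}. 0 < a i) \<and> complex_of_dim ((\<Sum>i=1..m. a i) - 1) \<Delta> \<and>
     (\<exists>\<kappa>. coloring m a \<Delta> \<kappa>)"


section \<open>Infinitesimal rigidity\<close>

text \<open>A graph is a pair of a vertex set and a set of two-element edges.\<close>

type_synonym 'v graph = "'v set \<times> 'v set set"

fun finite_simple_graph :: "'v graph \<Rightarrow> bool" where
  "finite_simple_graph (V, E) \<longleftrightarrow> finite V \<and> (\<forall>e\<in>E. e \<subseteq> V \<and> card e = 2)"

definition graph_of :: "'v set set \<Rightarrow> 'v graph" where
  "graph_of \<Delta> = (vertices \<Delta>, {e\<in>\<Delta>. card e = 2})"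

text \<open>Only the values of a point configuration on the vertex set matter.\<close>

fun framework :: "nat \<Rightarrow> 'v graph \<Rightarrow> ('v \<Rightarrow> real vec) \<Rightarrow> bool" where
  "framework d (V, E) p \<longleftrightarrow> finite_simple_graph (V, E) \<and> (\<forall>v\<in>V. p v \<in> carrier_vec d)"

fun infinitesimal_motion ::
  "nat \<Rightarrow> 'v graph \<Rightarrow> ('v \<Rightarrow> real vec) \<Rightarrow> ('v \<Rightarrow> real vec) \<Rightarrow> bool" where
  "infinitesimal_motion d (V, E) p q \<longleftrightarrow>
     (\<forall>v\<in>V. q v \<in> carrier_vec d) \<and>
     (\<forall>u v. {u, v} \<in> E \<longrightarrow> (p u - p v) \<bullet> (q u - q v) = 0)"

fun trivial_motion ::
  "nat \<Rightarrow> 'v graph \<Rightarrow> ('v \<Rightarrow> real vec) \<Rightarrow> ('v \<Rightarrow> real vec) \<Rightarrow> bool" where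
  "trivial_motion d (V, E) p q \<longleftrightarrow>
     (\<exists>S\<in>carrier_mat d d. \<exists>t\<in>carrier_vec d.
        transpose_mat S = - S \<and> (\<forall>v\<in>V. q v = S *\<^sub>v p v + t))"

definition infinitesimally_rigid :: "nat \<Rightarrow> 'v graph \<Rightarrow> ('v \<Rightarrow> real vec) \<Rightarrow> bool" where
  "infinitesimally_rigid d G p \<longleftrightarrow>
     framework d G p \<and>
     (\<forall>q. infinitesimal_motion d G p q \<longrightarrow> trivial_motion d G p q)"


section \<open>Sparse rigidity\<close>

text \<open>Coordinates of \<open>real vec\<close> are numbered from 0. Identifying \<open>\<real>\<^sup>d\<close> with the product of the
  \<open>\<real>\<close>-spaces of dimensions \<open>a 1, \<dots>, a m\<close> by concatenation, \<open>block a i\<close> is the set of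
  coordinates of the \<open>i\<close>-th factor.\<close>

definition block :: "(nat \<Rightarrow> nat) \<Rightarrow> nat \<Rightarrow> nat set" where
  "block a i = {(\<Sum>j=1..<i. a j) ..< (\<Sum>j=1..i. a j)}"

definition H :: "nat \<Rightarrow> (nat \<Rightarrow> nat) \<Rightarrow> nat \<Rightarrow> real vec set" where
  "H m a i =
     {x \<in> carrier_vec (\<Sum>j=1..m. a j). \<forall>j\<in>{1..m}. j \<noteq> i \<longrightarrow> (\<forall>k\<in>block a j. x $ k = 0)}"

fun sparse ::
  "nat \<Rightarrow> (nat \<Rightarrow> nat) \<Rightarrow> ('v \<Rightarrow> nat) \<Rightarrow> 'v graph \<Rightarrow> ('v \<Rightarrow> real vec) \<Rightarrow> bool" where
  "sparse m a \<kappa> (V, E) p \<longleftrightarrow> (\<forall>v\<in>V. p v \<in> H m a (\<kappa> v))"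

definition sparse_rigid :: "nat \<Rightarrow> (nat \<Rightarrow> nat) \<Rightarrow> ('v \<Rightarrow> nat) \<Rightarrow> 'v graph \<Rightarrow> bool" where
  "sparse_rigid m a \<kappa> G \<longleftrightarrow>
     (\<exists>p. sparse m a \<kappa> G p \<and> infinitesimally_rigid (\<Sum>i=1..m. a i) G p)"

end

theory Submission
  imports Defs "Jordan_Normal_Form.Determinant" "HOL-Computational_Algebra.Polynomial"
begin

text \<open>The proof is Fogelsanger's: induction on the number of vertices by contracting an edge
  \<open>{u, v}\<close>. Since every \<open>a i\<close> is at least 2, each facet has an edge whose ends have the same color,
  and contracting it preserves the coloring. Discard from the minimal cycle \<open>c\<close> the facets that
  contain \<open>{u, v}\<close> and split the remaining chain into pieces, the smallest nonempty subchains whose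
  contraction is a cycle. The contraction of a piece is a minimal cycle or a single facet, hence
  rigid in generic sparse position by induction, and vertex splitting shows that the piece together
  with the edge \<open>{u, v}\<close> is rigid. A motion that is trivial on one piece is trivial on every piece
  meeting it in a set \<open>K \<union> {u, v}\<close> with \<open>d\<close> elements, and minimality of \<open>c\<close> connects all pieces in
  this way. ``Generic'' means: wherever a suitable function that is polynomial along all lines does
  not vanish.\<close>

section \<open>Polynomials along curves and linear systems\<close>

text \<open>The obstacle is vertex splitting in sparse position. A face \<open>K\<close> with
  \<open>\<beta> B K \<noteq> 0\<close> makes \<open>u\<close> and \<open>v\<close> adjacent to the
  same d - 2 vertices, one fewer than splitting needs, and the colors restrict both these neighbours
  and the direction in which \<open>u\<close> may leave \<open>v\<close>. The missing neighbour
  comes from filling the discarded facets in again: this gives a cycle, so the facet on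
  \<open>K\<close>, \<open>u\<close>, \<open>v\<close> shares each of its ridges with another facet.
  Which ridge to cross is dictated by the colors, and here it matters a second time that no color
  owns exactly one coordinate. As the subspaces of the colors pass through the origin, a set with
  few enough vertices of each color fits on distinct unit vectors. With all other vertices at the
  origin, this configuration witnesses every genericity claim about points. Rigidity is instead
  tested in the degenerate limit where \<open>u\<close> sits on \<open>v\<close>. The contraction of
  a piece may cancel to 0. Minimality of the piece then leaves just two facets with the same image,
  which is why a single facet occurs beside the minimal cycles.\<close>

definition poly_along :: "(real \<Rightarrow> 'x) \<Rightarrow> ('x \<Rightarrow> real) \<Rightarrow> bool" where
  "poly_along \<gamma> f \<longleftrightarrow> (\<exists>P. \<forall>t. f (\<gamma> t) = poly P t)"

lemma poly_along_const [intro]: "poly_along \<gamma> (\<lambda>x. c)"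
  unfolding poly_along_def by (rule exI[of _ "[:c:]"]) simp

lemma poly_along_add [intro]:
  "poly_along \<gamma> f \<Longrightarrow> poly_along \<gamma> g \<Longrightarrow> poly_along \<gamma> (\<lambda>x. f x + g x)"
  unfolding poly_along_def by (metis poly_add)

lemma poly_along_diff [intro]:
  "poly_along \<gamma> f \<Longrightarrow> poly_along \<gamma> g \<Longrightarrow> poly_along \<gamma> (\<lambda>x. f x - g x)"
  unfolding poly_along_def by (metis poly_diff)

lemma poly_along_mult [intro]:
  "poly_along \<gamma> f \<Longrightarrow> poly_along \<gamma> g \<Longrightarrow> poly_along \<gamma> (\<lambda>x. f x * g x)"
  unfolding poly_along_def by (metis poly_mult)

lemma poly_along_sum [intro]:
  "(\<And>i. i \<in> I \<Longrightarrow> poly_along \<gamma> (f i)) \<Longrightarrow> poly_along \<gamma> (\<lambda>x. \<Sum>i\<in>I. f i x)"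
  by (induction I rule: infinite_finite_induct) auto

lemma poly_along_prod [intro]:
  "(\<And>i. i \<in> I \<Longrightarrow> poly_along \<gamma> (f i)) \<Longrightarrow> poly_along \<gamma> (\<lambda>x. \<Prod>i\<in>I. f i x)"
  by (induction I rule: infinite_finite_induct) auto

lemma poly_along_if [intro]:
  "(b \<Longrightarrow> poly_along \<gamma> f) \<Longrightarrow> (\<not> b \<Longrightarrow> poly_along \<gamma> g) \<Longrightarrow>
    poly_along \<gamma> (\<lambda>x. if b then f x else g x)"
  by (cases b) simp_all

lemma poly_along_det:
  assumes "\<And>i j. i < n \<Longrightarrow> j < n \<Longrightarrow> poly_along \<gamma> (\<lambda>x. A x i j)"
  shows "poly_along \<gamma> (\<lambda>x. det (mat n n (\<lambda>(i, j). A x i j)))"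
proof -
  have "det (mat n n (\<lambda>(i, j). A x i j)) =
      (\<Sum>p | p permutes {0..<n}. signof p * (\<Prod>i = 0..<n. A x i (p i)))" for x
    unfolding det_def by (auto intro!: sum.cong prod.cong)
  then show ?thesis
    by (auto intro!: poly_along_sum poly_along_mult poly_along_prod assms)
qed

lemma poly_along_finite_zeros:
  assumes "poly_along \<gamma> f" and "f (\<gamma> s) \<noteq> 0"
  shows "finite {t. f (\<gamma> t) = 0}"
proof -
  obtain P where P: "\<And>t. f (\<gamma> t) = poly P t"
    using assms(1) unfolding poly_along_def by blast
  with assms(2) have "P \<noteq> 0" by force
  then show ?thesis unfolding P by (rule poly_roots_finite)
qed

text \<open>\<open>D\<close> is the determinant of the Gram matrix of the system. Over the reals a
  vector in the kernel of the Gram matrix has image of squared norm 0, so the matrix and the system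
  have the same kernel. A rank condition on a rectangular system thus becomes the nonvanishing of
  one polynomial.\<close>

lemma linear_system_discriminant:
  fixes \<alpha> :: "'j \<Rightarrow> 'i \<Rightarrow> 'x \<Rightarrow> real"
  assumes I: "finite I" and J: "finite J"
  obtains D where
    "\<And>\<gamma>. (\<And>j i. j \<in> J \<Longrightarrow> i \<in> I \<Longrightarrow> poly_along \<gamma> (\<alpha> j i)) \<Longrightarrow> poly_along \<gamma> D"
    "\<And>x. D x \<noteq> 0 \<longleftrightarrow> (\<forall>q. (\<forall>j\<in>J. (\<Sum>i\<in>I. \<alpha> j i x * q i) = 0) \<longrightarrow> (\<forall>i\<in>I. q i = 0))"
proof -
  obtain h where h: "bij_betw h {0..<card I} I"
    using I ex_bij_betw_nat_finite by blast
  define n where "n = card I"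
  have hI: "h k \<in> I" if "k < n" for k
    using h that unfolding bij_betw_def n_def by auto
  define Gm where "Gm x k l = (\<Sum>j\<in>J. \<alpha> j (h k) x * \<alpha> j (h l) x)" for x k l
  define D where "D x = det (mat n n (\<lambda>(k, l). Gm x k l))" for x
  have reindex: "(\<Sum>i\<in>I. f i) = (\<Sum>k = 0..<n. f (h k))" for f :: "'i \<Rightarrow> real"
    unfolding n_def using sum.reindex_bij_betw[OF h, of f] by simp
  have poly: "poly_along \<gamma> D"
    if "\<And>j i. j \<in> J \<Longrightarrow> i \<in> I \<Longrightarrow> poly_along \<gamma> (\<alpha> j i)" for \<gamma>
    unfolding D_def Gm_def by (intro poly_along_det poly_along_sum poly_along_mult that hI)
  have Gm_vec: "(mat n n (\<lambda>(k, l). Gm x k l) *\<^sub>v v) $ k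
      = (\<Sum>j\<in>J. \<alpha> j (h k) x * (\<Sum>l = 0..<n. \<alpha> j (h l) x * v $ l))"
    if "v \<in> carrier_vec n" "k < n" for x v k
  proof -
    have "(mat n n (\<lambda>(k, l). Gm x k l) *\<^sub>v v) $ k = (\<Sum>l = 0..<n. Gm x k l * v $ l)"
      using that by (auto simp: scalar_prod_def)
    also have "\<dots> = (\<Sum>l = 0..<n. \<Sum>j\<in>J. \<alpha> j (h k) x * (\<alpha> j (h l) x * v $ l))"
      unfolding Gm_def by (simp add: sum_distrib_right mult.assoc)
    also have "\<dots> = (\<Sum>j\<in>J. \<alpha> j (h k) x * (\<Sum>l = 0..<n. \<alpha> j (h l) x * v $ l))"
      by (subst sum.swap) (simp add: sum_distrib_left)
    finally show ?thesis .
  qed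
  have "D x \<noteq> 0 \<longleftrightarrow> (\<forall>q. (\<forall>j\<in>J. (\<Sum>i\<in>I. \<alpha> j i x * q i) = 0) \<longrightarrow> (\<forall>i\<in>I. q i = 0))" for x
  proof (intro iffI allI impI)
    fix q assume D: "D x \<noteq> 0" and q: "\<forall>j\<in>J. (\<Sum>i\<in>I. \<alpha> j i x * q i) = 0"
    define v where "v = vec n (\<lambda>k. q (h k))"
    have v: "v \<in> carrier_vec n" unfolding v_def by simp
    have "mat n n (\<lambda>(k, l). Gm x k l) *\<^sub>v v = 0\<^sub>v n"
    proof (rule eq_vecI)
      fix k assume "k < dim_vec (0\<^sub>v n)"
      then have k: "k < n" by simp
      show "(mat n n (\<lambda>(k, l). Gm x k l) *\<^sub>v v) $ k = 0\<^sub>v n $ k"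
        unfolding Gm_vec[OF v k] using q k by (simp add: reindex v_def)
    qed simp
    then have "v = 0\<^sub>v n"
      using D det_0_iff_vec_prod_zero[of "mat n n (\<lambda>(k, l). Gm x k l)" n] v unfolding D_def by auto
    then have "q (h k) = 0" if "k < n" for k
      using that unfolding v_def by (metis index_vec index_zero_vec(1))
    then show "\<forall>i\<in>I. q i = 0"
      using h unfolding bij_betw_def n_def by (metis atLeastLessThan_iff imageE)
  next
    assume inj: "\<forall>q. (\<forall>j\<in>J. (\<Sum>i\<in>I. \<alpha> j i x * q i) = 0) \<longrightarrow> (\<forall>i\<in>I. q i = 0)"
    show "D x \<noteq> 0"
    proof
      assume "D x = 0"
      then obtain v where v: "v \<in> carrier_vec n" "v \<noteq> 0\<^sub>v n"
        and Gv: "mat n n (\<lambda>(k, l). Gm x k l) *\<^sub>v v = 0\<^sub>v n"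
        using det_0_iff_vec_prod_zero[of "mat n n (\<lambda>(k, l). Gm x k l)" n] unfolding D_def by auto
      define q where "q i = v $ (inv_into {0..<n} h i)" for i
      have qh: "q (h k) = v $ k" if "k < n" for k
        using h that unfolding q_def bij_betw_def n_def by simp
      define L where "L j = (\<Sum>l = 0..<n. \<alpha> j (h l) x * v $ l)" for j
      have "(\<Sum>j\<in>J. L j * L j) = (\<Sum>j\<in>J. \<Sum>k = 0..<n. v $ k * (\<alpha> j (h k) x * L j))"
        by (rule sum.cong)
          (simp_all add: L_def sum_distrib_right sum_distrib_left ac_simps)
      also have "\<dots> = (\<Sum>k = 0..<n. v $ k * (\<Sum>j\<in>J. \<alpha> j (h k) x * L j))"
        by (subst sum.swap) (simp add: sum_distrib_left)
      also have "\<dots> = (\<Sum>k = 0..<n. v $ k * (mat n n (\<lambda>(k, l). Gm x k l) *\<^sub>v v) $ k)"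
        unfolding L_def by (rule sum.cong) (auto simp del: index_mult_mat_vec simp: Gm_vec[OF v(1)])
      also have "\<dots> = 0" unfolding Gv by simp
      finally have "\<forall>j\<in>J. L j = 0"
        using J by (simp add: sum_nonneg_eq_0_iff)
      then have "\<forall>j\<in>J. (\<Sum>i\<in>I. \<alpha> j i x * q i) = 0"
        unfolding reindex L_def using qh by simp
      with inj have "\<forall>i\<in>I. q i = 0" by blast
      then have "v = 0\<^sub>v n"
        using qh hI v(1) by (metis carrier_vecD eq_vecI index_zero_vec)
      with v(2) show False by simp
    qed
  qed
  with poly that show thesis by blast
qed

text \<open>The vectors \<open>p i\<close> are the rows of an invertible matrix \<open>P\<close>,
  and the \<open>r i\<close> are the columns of its inverse \<open>B\<close>. The two identities are
  \<open>P * B = 1\<close> and \<open>B * P = 1\<close>.\<close>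

lemma square_system_dual:
  fixes p :: "'i \<Rightarrow> nat \<Rightarrow> real"
  assumes I: "finite I" "card I = d"
    and inj: "\<And>y. (\<And>i. i \<in> I \<Longrightarrow> (\<Sum>k<d. y k * p i k) = 0) \<Longrightarrow> (\<forall>k<d. y k = 0)"
  obtains r where
    "\<And>i j. i \<in> I \<Longrightarrow> j \<in> I \<Longrightarrow> (\<Sum>k<d. r i k * p j k) = (if i = j then 1 else 0)"
    "\<And>k l. k < d \<Longrightarrow> l < d \<Longrightarrow> (\<Sum>i\<in>I. r i k * p i l) = (if k = l then 1 else 0)"
proof -
  obtain h where h: "bij_betw h {0..<d} I"
    using I ex_bij_betw_nat_finite by metis
  define P where "P = mat d d (\<lambda>(i, k). p (h i) k)"
  have P: "P \<in> carrier_mat d d" unfolding P_def by simp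
  have hI: "h k \<in> I" if "k < d" for k
    using h that unfolding bij_betw_def by auto
  define g where "g = inv_into {0..<d} h"
  have g: "g i < d" "h (g i) = i" if "i \<in> I" for i
    using h that unfolding g_def bij_betw_def
    by (metis atLeastLessThan_iff inv_into_into, metis f_inv_into_f)
  have gh: "g (h k) = k" if "k < d" for k
    using h that unfolding g_def bij_betw_def by simp
  have "det P \<noteq> 0"
  proof
    assume "det P = 0"
    then obtain v where v: "v \<in> carrier_vec d" "v \<noteq> 0\<^sub>v d" "P *\<^sub>v v = 0\<^sub>v d"
      using det_0_iff_vec_prod_zero[OF P] by auto
    have "(\<Sum>k<d. v $ k * p i k) = 0" if "i \<in> I" for i
    proof -
      have "(P *\<^sub>v v) $ g i = (\<Sum>k<d. v $ k * p i k)"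
        using g[OF that] v(1) unfolding P_def
        by (auto simp: scalar_prod_def lessThan_atLeast0 ac_simps intro!: sum.cong)
      then show ?thesis using v(3) g[OF that] by simp
    qed
    then have "\<forall>k<d. v $ k = 0" by (rule inj)
    then show False using v by (metis carrier_vecD eq_vecI index_zero_vec)
  qed
  then obtain B where B: "B \<in> carrier_mat d d" "B * P = 1\<^sub>m d" "P * B = 1\<^sub>m d"
    using det_non_zero_imp_unit[OF P, of "()"] unfolding Units_def ring_mat_def by auto
  define r where "r i k = B $$ (k, g i)" for i k
  show thesis
  proof (rule that[of r])
    fix i j assume ij: "i \<in> I" "j \<in> I"
    have "(P * B) $$ (g j, g i) = (\<Sum>k<d. r i k * p j k)"
      using g[OF ij(1)] g[OF ij(2)] B(1) unfolding P_def r_def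
      by (auto simp: scalar_prod_def lessThan_atLeast0 ac_simps intro!: sum.cong)
    moreover have "g i = g j \<longleftrightarrow> i = j" using g[OF ij(1)] g[OF ij(2)] by metis
    ultimately show "(\<Sum>k<d. r i k * p j k) = (if i = j then 1 else 0)"
      unfolding B(3) using g[OF ij(1)] g[OF ij(2)] by auto
  next
    fix k l assume kl: "k < d" "l < d"
    have "(B * P) $$ (k, l) = (\<Sum>i = 0..<d. r (h i) k * p (h i) l)"
      using kl B(1) unfolding P_def r_def
      by (auto simp: scalar_prod_def gh intro!: sum.cong)
    also have "\<dots> = (\<Sum>i\<in>I. r i k * p i l)"
      using sum.reindex_bij_betw[OF h] .
    finally show "(\<Sum>i\<in>I. r i k * p i l) = (if k = l then 1 else 0)"
      unfolding B(2) using kl by auto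
  qed
qed

section \<open>Generic configurations\<close>

definition line :: "('v \<Rightarrow> nat \<Rightarrow> real) \<Rightarrow> ('v \<Rightarrow> nat \<Rightarrow> real) \<Rightarrow> real \<Rightarrow> 'v \<Rightarrow> nat \<Rightarrow> real" where
  "line p q t = (\<lambda>v k. p v k + t * q v k)"

text \<open>A substitute for containing a nonempty Zariski-open set. Only restrictions of
  \<open>D\<close> to lines have to be polynomials, since \<open>generic_conj\<close> works on a
  single line.\<close>

definition generic :: "(('v \<Rightarrow> nat \<Rightarrow> real) \<Rightarrow> bool) \<Rightarrow> bool" where
  "generic R \<longleftrightarrow> (\<exists>D. (\<forall>p q. poly_along (line p q) D) \<and> (\<exists>p. D p \<noteq> 0) \<and> (\<forall>p. D p \<noteq> 0 \<longrightarrow> R p))"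

lemma generic_exists: "generic R \<Longrightarrow> \<exists>p. R p"
  unfolding generic_def by blast

lemma generic_mono: "generic R \<Longrightarrow> (\<And>p. R p \<Longrightarrow> Q p) \<Longrightarrow> generic Q"
  unfolding generic_def by blast

lemma generic_True: "generic (\<lambda>_. True)"
  unfolding generic_def by (rule exI[of _ "\<lambda>_. 1"]) auto

text \<open>On the line that joins a nonzero of one function to a nonzero of the other, both
  restrict to nonzero polynomials in one variable, which have finitely many roots.\<close>

lemma generic_conj:
  fixes R Q :: "('v \<Rightarrow> nat \<Rightarrow> real) \<Rightarrow> bool"
  assumes "generic R" "generic Q"
  shows "generic (\<lambda>p. R p \<and> Q p)"
proof -
  obtain f p where f: "\<And>p q. poly_along (line p q) f" "f p \<noteq> 0" "\<And>p. f p \<noteq> 0 \<Longrightarrow> R p"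
    using assms(1) unfolding generic_def by blast
  obtain g q where g: "\<And>p q. poly_along (line p q) g" "g q \<noteq> 0" "\<And>p. g p \<noteq> 0 \<Longrightarrow> Q p"
    using assms(2) unfolding generic_def by blast
  define z where "z = (\<lambda>v k. q v k - p v k)"
  have "line p z 0 = p" "line p z 1 = q" unfolding line_def z_def by auto
  then have "finite {t. f (line p z t) = 0}" "finite {t. g (line p z t) = 0}"
    using poly_along_finite_zeros[OF f(1), of p z 0] poly_along_finite_zeros[OF g(1), of p z 1] f(2) g(2)
    by simp_all
  then have "finite ({t. f (line p z t) = 0} \<union> {t. g (line p z t) = 0})" by simp
  then obtain t where "f (line p z t) \<noteq> 0" "g (line p z t) \<noteq> 0"
    using ex_new_if_finite[OF infinite_UNIV_char_0] by blast
  then have "f (line p z t) * g (line p z t) \<noteq> 0" by simp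
  moreover have "\<forall>p q. poly_along (line p q) (\<lambda>x. f x * g x)" using f(1) g(1) by blast
  ultimately show ?thesis unfolding generic_def using f(3) g(3)
    by (intro exI[of _ "\<lambda>x. f x * g x"]) auto
qed

lemma generic_Ball:
  assumes "finite A" "\<And>a. a \<in> A \<Longrightarrow> generic (R a)"
  shows "generic (\<lambda>p. \<forall>a\<in>A. R a p)"
  using assms
proof (induction A)
  case empty
  then show ?case by (simp add: generic_True)
next
  case (insert a A)
  then have "generic (\<lambda>p. R a p \<and> (\<forall>a\<in>A. R a p))" by (intro generic_conj) auto
  then show ?case by (rule generic_mono) auto
qed

text \<open>A single configuration \<open>x0\<close> with trivial kernel suffices, because it shows
  that the discriminant is not identically 0.\<close>

lemma generic_linear_system:
  fixes \<alpha> :: "'j \<Rightarrow> 'i \<Rightarrow> ('v \<Rightarrow> nat \<Rightarrow> real) \<Rightarrow> real"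
  assumes "finite I" "finite J"
    and "\<And>j i p q. j \<in> J \<Longrightarrow> i \<in> I \<Longrightarrow> poly_along (line p q) (\<alpha> j i)"
    and "\<And>q i. (\<And>j. j \<in> J \<Longrightarrow> (\<Sum>i\<in>I. \<alpha> j i x0 * q i) = 0) \<Longrightarrow> i \<in> I \<Longrightarrow> q i = 0"
  shows "generic (\<lambda>x. \<forall>q. (\<forall>j\<in>J. (\<Sum>i\<in>I. \<alpha> j i x * q i) = 0) \<longrightarrow> (\<forall>i\<in>I. q i = 0))"
proof -
  obtain D where D: "\<And>\<gamma>. (\<And>j i. j \<in> J \<Longrightarrow> i \<in> I \<Longrightarrow> poly_along \<gamma> (\<alpha> j i)) \<Longrightarrow> poly_along \<gamma> D"
    "\<And>x. D x \<noteq> 0 \<longleftrightarrow> (\<forall>q. (\<forall>j\<in>J. (\<Sum>i\<in>I. \<alpha> j i x * q i) = 0) \<longrightarrow> (\<forall>i\<in>I. q i = 0))"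
    by (rule linear_system_discriminant[OF assms(1,2), of \<alpha>]) blast
  have "D x0 \<noteq> 0" unfolding D(2) using assms(4) by blast
  moreover have "poly_along (line p q) D" for p q by (rule D(1)) (rule assms(3))
  ultimately show ?thesis unfolding generic_def using D(2) by blast
qed

section \<open>Frameworks in sparse position\<close>

locale colored_space =
  fixes d :: nat and col :: "nat \<Rightarrow> nat" and \<kappa> :: "'v \<Rightarrow> nat"
begin

text \<open>Projecting an arbitrary \<open>x\<close> onto the sparse configurations leaves
  \<open>x\<close> itself unconstrained, so that lines between configurations stay available and
  genericity still speaks of sparse positions.\<close>

definition sparsify :: "('v \<Rightarrow> nat \<Rightarrow> real) \<Rightarrow> 'v \<Rightarrow> nat \<Rightarrow> real" where
  "sparsify x v k = (if col k = \<kappa> v then x v k else 0)"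

text \<open>Edges are ordered pairs. A loop imposes 0 = 0, so \<open>F \<times> F\<close> can serve
  as the clique on \<open>F\<close>, and edges that collapse under contraction do no harm.\<close>

definition motion :: "('v \<times> 'v) set \<Rightarrow> ('v \<Rightarrow> nat \<Rightarrow> real) \<Rightarrow> ('v \<Rightarrow> nat \<Rightarrow> real) \<Rightarrow> bool" where
  "motion E p q \<longleftrightarrow> (\<forall>(a, b)\<in>E. (\<Sum>k<d. (p a k - p b k) * (q a k - q b k)) = 0)"

definition skew :: "(nat \<Rightarrow> nat \<Rightarrow> real) \<Rightarrow> bool" where
  "skew S \<longleftrightarrow> (\<forall>k<d. \<forall>l<d. S k l = - S l k)"

definition rigid :: "'v set \<Rightarrow> ('v \<times> 'v) set \<Rightarrow> ('v \<Rightarrow> nat \<Rightarrow> real) \<Rightarrow> bool" where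
  "rigid V E p \<longleftrightarrow> (\<forall>q. motion E p q \<longrightarrow>
     (\<exists>S t. skew S \<and> (\<forall>v\<in>V. \<forall>k<d. q v k = (\<Sum>l<d. S k l * p v l) + t k)))"

text \<open>Fixing \<open>F\<close> replaces rigidity modulo trivial motions by the triviality of
  the kernel of a linear system, to which discriminants apply.\<close>

definition pinned :: "'v set \<Rightarrow> ('v \<times> 'v) set \<Rightarrow> 'v set \<Rightarrow> ('v \<Rightarrow> nat \<Rightarrow> real) \<Rightarrow> bool" where
  "pinned V E F p \<longleftrightarrow>
     (\<forall>q. motion E p q \<and> (\<forall>f\<in>F. \<forall>k<d. q f k = 0) \<longrightarrow> (\<forall>v\<in>V. \<forall>k<d. q v k = 0))"

text \<open>For d points this is linear, not merely affine, independence; it provides the dual basis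
  used in \<open>clique_motion_trivial\<close>.\<close>

definition spanning :: "'v set \<Rightarrow> ('v \<Rightarrow> nat \<Rightarrow> real) \<Rightarrow> bool" where
  "spanning F p \<longleftrightarrow> (\<forall>y. (\<forall>f\<in>F. (\<Sum>k<d. p f k * y k) = 0) \<longrightarrow> (\<forall>k<d. y k = 0))"

text \<open>Affine independence of \<open>d\<close> points, in the form in which it is used for gluing.\<close>

definition nondeg :: "'v set \<Rightarrow> ('v \<Rightarrow> nat \<Rightarrow> real) \<Rightarrow> bool" where
  "nondeg F p \<longleftrightarrow> (\<forall>S t. skew S \<and> (\<forall>f\<in>F. \<forall>k<d. (\<Sum>l<d. S k l * p f l) + t k = 0)
     \<longrightarrow> (\<forall>k<d. t k = 0 \<and> (\<forall>l<d. S k l = 0)))"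

text \<open>Here \<open>p u\<close> is the direction in which \<open>u\<close> leaves \<open>v\<close>, not the position of a vertex.\<close>

definition splitting :: "'v set \<Rightarrow> 'v \<Rightarrow> 'v \<Rightarrow> ('v \<Rightarrow> nat \<Rightarrow> real) \<Rightarrow> bool" where
  "splitting W u v p \<longleftrightarrow>
     (\<forall>y. (\<forall>w\<in>W. (\<Sum>k<d. (p v k - p w k) * y k) = 0) \<and> (\<Sum>k<d. p u k * y k) = 0
        \<longrightarrow> (\<forall>k<d. y k = 0))"

definition fits :: "('v \<Rightarrow> nat) \<Rightarrow> 'v set \<Rightarrow> bool" where
  "fits \<phi> A \<longleftrightarrow> inj_on \<phi> A \<and> (\<forall>v\<in>A. \<phi> v < d \<and> col (\<phi> v) = \<kappa> v)"

text \<open>The common witness for \<open>generic_spanning\<close>, \<open>generic_splitting\<close>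
  and \<open>generic_nondeg\<close>.\<close>

definition unit_config :: "('v \<Rightarrow> nat) \<Rightarrow> 'v set \<Rightarrow> 'v \<Rightarrow> nat \<Rightarrow> real" where
  "unit_config \<phi> A v k = (if v \<in> A \<and> k = \<phi> v then 1 else 0)"

lemma poly_along_sparsify: "poly_along (line p q) (\<lambda>x. sparsify x v k)"
  unfolding poly_along_def sparsify_def line_def
  by (rule exI[of _ "if col k = \<kappa> v then [:p v k, q v k:] else 0"]) simp

text \<open>Inject each color class separately. The injections glue, because the color of the
  coordinate \<open>\<phi> v\<close> recovers the class of \<open>v\<close>.\<close>

lemma fits_exists:
  assumes "finite A"
    and "\<And>i. card {v \<in> A. \<kappa> v = i} \<le> card {k. k < d \<and> col k = i}"
  shows "\<exists>\<phi>. fits \<phi> A"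
proof -
  have "\<forall>i. \<exists>f. f ` {v \<in> A. \<kappa> v = i} \<subseteq> {k. k < d \<and> col k = i} \<and> inj_on f {v \<in> A. \<kappa> v = i}"
    using assms by (intro allI card_le_inj) auto
  from choice[OF this] obtain f where f: "\<forall>i. f i ` {v \<in> A. \<kappa> v = i} \<subseteq> {k. k < d \<and> col k = i} \<and>
    inj_on (f i) {v \<in> A. \<kappa> v = i}" ..
  define \<phi> where "\<phi> v = f (\<kappa> v) v" for v
  have *: "\<phi> v < d \<and> col (\<phi> v) = \<kappa> v" if "v \<in> A" for v
    using f that unfolding \<phi>_def by blast
  have "inj_on \<phi> A"
  proof (rule inj_onI)
    fix v w assume vw: "v \<in> A" "w \<in> A" "\<phi> v = \<phi> w"
    then have "\<kappa> v = \<kappa> w" using * by metis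
    then show "v = w" using spec[OF f, of "\<kappa> w"] vw unfolding \<phi>_def inj_on_def by auto
  qed
  with * show ?thesis unfolding fits_def by blast
qed

lemma fits_image: "fits \<phi> A \<Longrightarrow> card A = d \<Longrightarrow> \<phi> ` A = {..<d}"
  unfolding fits_def by (metis card_image card_lessThan card_subset_eq finite_lessThan
      image_subsetI lessThan_iff)

lemma sparsify_unit_config:
  "fits \<phi> A \<Longrightarrow> sparsify (unit_config \<phi> A) v = (\<lambda>k. if v \<in> A \<and> k = \<phi> v then 1 else 0)"
  unfolding sparsify_def unit_config_def fits_def by (rule ext) auto

lemma sum_unit_config:
  assumes "fits \<phi> A" "v \<in> A"
  shows "(\<Sum>k<d. sparsify (unit_config \<phi> A) v k * y k) = y (\<phi> v)"
proof -
  have "(\<Sum>k<d. sparsify (unit_config \<phi> A) v k * y k) = (\<Sum>k<d. if k = \<phi> v then y k else 0)"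
    unfolding sparsify_unit_config[OF assms(1)] using assms(2) by (intro sum.cong) auto
  also have "\<dots> = y (\<phi> v)" using assms unfolding fits_def by simp
  finally show ?thesis .
qed

lemma sum_unit_config_0:
  assumes "fits \<phi> A" "v \<notin> A"
  shows "sparsify (unit_config \<phi> A) v k = 0"
  unfolding sparsify_unit_config[OF assms(1)] using assms(2) by simp

section \<open>Genericity of the position of d points\<close>

lemma generic_spanning:
  assumes F: "finite F" "card F = d" "fits \<phi> F"
  shows "generic (\<lambda>x. spanning F (sparsify x))"
proof -
  have "generic (\<lambda>x. \<forall>y. (\<forall>f\<in>F. (\<Sum>k\<in>{..<d}. sparsify x f k * y k) = 0) \<longrightarrow> (\<forall>k\<in>{..<d}. y k = 0))"
  proof (rule generic_linear_system[where ?x0.0 = "unit_config \<phi> F"])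
    fix y :: "nat \<Rightarrow> real" and k
    assume y: "\<And>f. f \<in> F \<Longrightarrow> (\<Sum>k<d. sparsify (unit_config \<phi> F) f k * y k) = 0" and "k \<in> {..<d}"
    then obtain f where "f \<in> F" "k = \<phi> f" using fits_image[OF F(3,2)] by blast
    then show "y k = 0" using y[of f] sum_unit_config[OF F(3), of f y] by simp
  qed (use F poly_along_sparsify in auto)
  then show ?thesis unfolding spanning_def by (rule generic_mono) auto
qed

text \<open>The two alternatives say which vertex of the unit configuration sits at the origin:
  \<open>v\<close> itself, or some \<open>w\<close> in \<open>W\<close>. Either way a row of the
  system, or the position of \<open>v\<close>, makes \<open>y\<close> orthogonal to the position of
  \<open>v\<close>. The remaining rows then annihilate the coordinates of \<open>y\<close> belonging
  to the vertices of \<open>A\<close>, and these are all coordinates.\<close>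

lemma generic_splitting:
  assumes W: "finite W" and A: "fits \<phi> A" "card A = d" "u \<in> A"
    and "v \<notin> A \<and> A \<subseteq> insert u W \<or> v \<in> A \<and> A \<subseteq> insert u (insert v W) \<and> \<not> W \<subseteq> A"
  shows "generic (\<lambda>x. splitting W u v (sparsify x))"
proof -
  define \<alpha> where "\<alpha> j k x = (case j of None \<Rightarrow> sparsify x u k | Some w \<Rightarrow> sparsify x v k - sparsify x w k)" for j k x
  let ?x = "unit_config \<phi> A"
  have "generic (\<lambda>x. \<forall>y. (\<forall>j\<in>insert None (Some ` W). (\<Sum>k\<in>{..<d}. \<alpha> j k x * y k) = 0)
      \<longrightarrow> (\<forall>k\<in>{..<d}. y k = 0))"
  proof (rule generic_linear_system[where ?x0.0 = ?x])
    fix j k p q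
    show "poly_along (line p q) (\<alpha> j k)"
      unfolding \<alpha>_def by (cases j) (auto intro: poly_along_sparsify)
  next
    fix y :: "nat \<Rightarrow> real" and k
    assume y: "\<And>j. j \<in> insert None (Some ` W) \<Longrightarrow> (\<Sum>k<d. \<alpha> j k ?x * y k) = 0" and "k \<in> {..<d}"
    then obtain a where a: "a \<in> A" "k = \<phi> a" using fits_image[OF A(1,2)] by blast
    have u0: "y (\<phi> u) = 0"
      using y[of None] sum_unit_config[OF A(1,3), of y] unfolding \<alpha>_def by simp
    have w: "(\<Sum>k<d. sparsify ?x v k * y k) = (\<Sum>k<d. sparsify ?x w k * y k)" if "w \<in> W" for w
      using y[of "Some w"] that unfolding \<alpha>_def by (simp add: algebra_simps sum_subtractf)
    have z: "(\<Sum>k<d. sparsify ?x b k * y k) = 0" if "b \<notin> A" for b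
      using that sum_unit_config_0[OF A(1)] by simp
    have v0: "(\<Sum>k<d. sparsify ?x v k * y k) = 0"
      using assms(5) w z by (metis subsetI)
    then show "y k = 0"
      using a u0 w[of a] assms(5) sum_unit_config[OF A(1), of _ y] by (metis insertE subsetD)
  qed (use W in auto)
  then show ?thesis
    unfolding splitting_def \<alpha>_def by (rule generic_mono) auto
qed

text \<open>Put \<open>f0\<close> at the origin and the other points at unit vectors. Vanishing at
  \<open>f0\<close> gives t = 0, vanishing at the others annihilates all columns of S but one, and
  skewness removes the one diagonal entry that is left. Leaving \<open>f0\<close> out of the fitting
  condition admits sets whose colors do not match the coordinates exactly.\<close>

lemma generic_nondeg:
  assumes F: "finite F" "card F = d" "f0 \<in> F" and \<phi>: "fits \<phi> (F - {f0})"
  shows "generic (\<lambda>x. nondeg F (sparsify x))"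
proof -
  \<comment> \<open>The unknowns are the entries of S, with t stored as column d. The
    \<open>Inl\<close> rows express skewness and the \<open>Inr\<close> rows vanishing at a point.
    The two conditionals are added so that a diagonal entry gets coefficient 2.\<close>
  define \<alpha> :: "(nat \<times> nat) + ('v \<times> nat) \<Rightarrow> nat \<times> nat \<Rightarrow> ('v \<Rightarrow> nat \<Rightarrow> real) \<Rightarrow> real"
    where "\<alpha> = (\<lambda>j (k', l') x. case j of
        Inl (k, l) \<Rightarrow> (if k' = k then if l' = l then 1 else 0 else 0)
          + (if k' = l then if l' = k then 1 else 0 else 0)
      | Inr (f, k) \<Rightarrow> (if k' = k then if l' = d then 1 else sparsify x f l' else 0))"
  let ?I = "{..<d} \<times> {..d}"
  let ?J = "({..<d} \<times> {..<d}) <+> (F \<times> {..<d})"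
  let ?x = "unit_config \<phi> (F - {f0})"
  have delta: "(\<Sum>i\<in>?I. (case i of (k', l') \<Rightarrow> if k' = k then g l' else 0) * q i)
      = (\<Sum>l\<le>d. g l * q (k, l))" if "k < d" for k :: nat and g :: "nat \<Rightarrow> real" and q
  proof -
    have "(\<Sum>i\<in>?I. (case i of (k', l') \<Rightarrow> if k' = k then g l' else 0) * q i)
      = (\<Sum>k'<d. \<Sum>l\<le>d. (if k' = k then g l else 0) * q (k', l))"
      unfolding sum.cartesian_product by (rule sum.cong) auto
    also have "\<dots> = (\<Sum>k'<d. if k' = k then (\<Sum>l\<le>d. g l * q (k, l)) else 0)"
      by (rule sum.cong) auto
    finally show ?thesis using that by simp
  qed
  have row1: "(\<Sum>i\<in>?I. \<alpha> (Inl (k, l)) i x * q i) = q (k, l) + q (l, k)" if "k < d" "l < d" for k l x q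
  proof -
    have "(\<Sum>i\<in>?I. \<alpha> (Inl (k, l)) i x * q i)
      = (\<Sum>i\<in>?I. (case i of (k', l') \<Rightarrow> if k' = k then if l' = l then 1 else 0 else 0) * q i)
      + (\<Sum>i\<in>?I. (case i of (k', l') \<Rightarrow> if k' = l then if l' = k then 1 else 0 else 0) * q i)"
      unfolding \<alpha>_def sum.distrib[symmetric] by (rule sum.cong) (auto simp: algebra_simps)
    also have "\<dots> = (\<Sum>l'\<le>d. if l' = l then q (k, l') else 0) + (\<Sum>l'\<le>d. if l' = k then q (l, l') else 0)"
      unfolding delta[OF that(1)] delta[OF that(2)]
      by (intro arg_cong2[where f = "(+)"] sum.cong) auto
    also have "\<dots> = q (k, l) + q (l, k)" using that by simp
    finally show ?thesis .
  qed
  have row2: "(\<Sum>i\<in>?I. \<alpha> (Inr (f, k)) i x * q i) = (\<Sum>l<d. q (k, l) * sparsify x f l) + q (k, d)"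
    if "k < d" for f k x q
  proof -
    have "(\<Sum>i\<in>?I. \<alpha> (Inr (f, k)) i x * q i) = (\<Sum>l\<le>d. (if l = d then 1 else sparsify x f l) * q (k, l))"
      unfolding delta[OF that, of "\<lambda>l. if l = d then 1 else sparsify x f l" q, symmetric] \<alpha>_def
      by (rule sum.cong) auto
    also have "\<dots> = (\<Sum>l<d. q (k, l) * sparsify x f l) + q (k, d)"
      by (simp add: lessThan_Suc_atMost[symmetric] ac_simps)
    finally show ?thesis .
  qed
  have "generic (\<lambda>x. \<forall>q. (\<forall>j\<in>?J. (\<Sum>i\<in>?I. \<alpha> j i x * q i) = 0) \<longrightarrow> (\<forall>i\<in>?I. q i = 0))"
  proof (rule generic_linear_system[where ?x0.0 = ?x])
    fix j i p q
    show "poly_along (line p q) (\<alpha> j i)"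
    proof (cases j)
      case (Inl a)
      then show ?thesis unfolding \<alpha>_def by (cases a; cases i) auto
    next
      case (Inr a)
      then show ?thesis unfolding \<alpha>_def
        by (cases a; cases i) (auto intro!: poly_along_if poly_along_const poly_along_sparsify)
    qed
  next
    fix q :: "nat \<times> nat \<Rightarrow> real" and i
    assume rows: "\<And>j. j \<in> ?J \<Longrightarrow> (\<Sum>i\<in>?I. \<alpha> j i ?x * q i) = 0" and i: "i \<in> ?I"
    have sk: "q (k, l) = - q (l, k)" if "k < d" "l < d" for k l
      using rows[of "Inl (k, l)"] row1[OF that, of ?x q] that by (simp add: Plus_def)
    have r: "(\<Sum>l<d. sparsify ?x f l * q (k, l)) + q (k, d) = 0" if "k < d" "f \<in> F" for k f
      using rows[of "Inr (f, k)"] row2[OF that(1), of f ?x q] that by (simp add: Plus_def ac_simps)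
    have t: "q (k, d) = 0" if "k < d" for k
      using r[OF that F(3)] sum_unit_config_0[OF \<phi>, of f0] by simp
    have col0: "q (k, \<phi> f) = 0" if "k < d" "f \<in> F - {f0}" for k f
      using r[OF that(1), of f] sum_unit_config[OF \<phi> that(2), of "\<lambda>l. q (k, l)"] t[OF that(1)] that
      by simp
    have sub: "\<phi> ` (F - {f0}) \<subseteq> {..<d}" and "card (\<phi> ` (F - {f0})) = d - 1"
      using \<phi> F unfolding fits_def by (auto simp: card_image)
    then have "card ({..<d} - \<phi> ` (F - {f0})) = d - (d - 1)"
      using F(1) by (subst card_Diff_subset) auto
    then have one: "card ({..<d} - \<phi> ` (F - {f0})) \<le> 1" by simp
    have S: "q (k, l) = 0" if "k < d" "l < d" for k l
    proof (cases "k \<in> \<phi> ` (F - {f0}) \<or> l \<in> \<phi> ` (F - {f0})")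
      case True
      then consider f where "f \<in> F - {f0}" "k = \<phi> f" | f where "f \<in> F - {f0}" "l = \<phi> f" by blast
      then show ?thesis
      proof cases
        case 1
        then have "q (l, k) = 0" using col0 that by simp
        then show ?thesis by (simp only: sk[OF that] minus_zero)
      next
        case 2
        then show ?thesis using col0 that by simp
      qed
    next
      case False
      then have "k = l"
        using one that card_le_Suc0_iff_eq[of "{..<d} - \<phi> ` (F - {f0})"] by auto
      then show ?thesis using sk[of k k] that by simp
    qed
    show "q i = 0" using i S t by (cases i) (auto simp: le_less)
  qed (use F in auto)
  then show ?thesis
  proof (rule generic_mono)
    fix x assume x: "\<forall>q. (\<forall>j\<in>?J. (\<Sum>i\<in>?I. \<alpha> j i x * q i) = 0) \<longrightarrow> (\<forall>i\<in>?I. q i = 0)"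
    show "nondeg F (sparsify x)"
      unfolding nondeg_def
    proof (intro allI impI, elim conjE)
      fix S t k0 assume S: "skew S" and t: "\<forall>f\<in>F. \<forall>k<d. (\<Sum>l<d. S k l * sparsify x f l) + t k = 0"
      define q where "q = (\<lambda>(k, l). if l = d then t k else S k l)"
      have "\<forall>j\<in>?J. (\<Sum>i\<in>?I. \<alpha> j i x * q i) = 0"
      proof
        fix j assume "j \<in> ?J"
        then consider k l where "j = Inl (k, l)" "k < d" "l < d"
          | f k where "j = Inr (f, k)" "k < d" "f \<in> F" by auto
        then show "(\<Sum>i\<in>?I. \<alpha> j i x * q i) = 0"
        proof cases
          case 1
          then have "S k l = - S l k" using S unfolding skew_def by blast
          then have "q (k, l) + q (l, k) = 0" using 1 unfolding q_def by simp
          then show ?thesis unfolding 1(1) row1[OF 1(2,3)] .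
        next
          case 2
          have "(\<Sum>l<d. q (k, l) * sparsify x f l) = (\<Sum>l<d. S k l * sparsify x f l)"
            unfolding q_def by (rule sum.cong) auto
          then show ?thesis unfolding 2(1) row2[OF 2(2)] using t 2 unfolding q_def by simp
        qed
      qed
      with x have q0: "\<forall>i\<in>?I. q i = 0" by blast
      have "t k = 0" if "k < d" for k using bspec[OF q0, of "(k, d)"] that unfolding q_def by simp
      moreover have "S k l = 0" if "k < d" "l < d" for k l
        using bspec[OF q0, of "(k, l)"] that unfolding q_def by simp
      moreover assume "k0 < d"
      ultimately show "t k0 = 0 \<and> (\<forall>l<d. S k0 l = 0)" by blast
    qed
  qed
qed

text \<open>The edge directions \<open>\<delta>\<close> are arbitrary functions of a parameter
  rather than differences of positions, because the splitting argument replaces the direction of one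
  edge by a limit.\<close>

lemma pinned_discriminant:
  fixes \<delta> :: "'x \<Rightarrow> 'v \<times> 'v \<Rightarrow> nat \<Rightarrow> real"
  assumes V: "finite V" and E: "E \<subseteq> V \<times> V" and F: "F \<subseteq> V"
  obtains D where
    "\<And>\<gamma>. (\<And>e k. e \<in> E \<Longrightarrow> poly_along \<gamma> (\<lambda>x. \<delta> x e k)) \<Longrightarrow> poly_along \<gamma> D"
    "\<And>x. D x \<noteq> 0 \<longleftrightarrow> (\<forall>q. (\<forall>(a, b)\<in>E. (\<Sum>k<d. \<delta> x (a, b) k * (q a k - q b k)) = 0) \<and>
       (\<forall>f\<in>F. \<forall>k<d. q f k = 0) \<longrightarrow> (\<forall>v\<in>V. \<forall>k<d. q v k = 0))"
proof -
  define \<alpha> :: "('v \<times> 'v) + ('v \<times> nat) \<Rightarrow> 'v \<times> nat \<Rightarrow> 'x \<Rightarrow> real" where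
    "\<alpha> = (\<lambda>j (w, k) x. case j of
        Inl (a, b) \<Rightarrow> (if w = a then \<delta> x (a, b) k else 0) - (if w = b then \<delta> x (a, b) k else 0)
      | Inr (f, l) \<Rightarrow> (if w = f then if k = l then 1 else 0 else 0))"
  let ?I = "V \<times> {..<d}"
  let ?J = "E <+> (F \<times> {..<d})"
  have fin: "finite ?I" "finite ?J"
    using V finite_subset[OF E] finite_subset[OF F] by auto
  obtain D where D: "\<And>\<gamma>. (\<And>j i. j \<in> ?J \<Longrightarrow> i \<in> ?I \<Longrightarrow> poly_along \<gamma> (\<alpha> j i)) \<Longrightarrow> poly_along \<gamma> D"
    "\<And>x. D x \<noteq> 0 \<longleftrightarrow> (\<forall>q. (\<forall>j\<in>?J. (\<Sum>i\<in>?I. \<alpha> j i x * q i) = 0) \<longrightarrow> (\<forall>i\<in>?I. q i = 0))"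
    by (rule linear_system_discriminant[OF fin, of \<alpha>]) blast
  have delta: "(\<Sum>i\<in>?I. (case i of (w, k) \<Rightarrow> if w = a then g k else 0) * q i)
      = (\<Sum>k<d. g k * q (a, k))" if "a \<in> V" for a and g :: "nat \<Rightarrow> real" and q
  proof -
    have "(\<Sum>i\<in>?I. (case i of (w, k) \<Rightarrow> if w = a then g k else 0) * q i)
      = (\<Sum>w\<in>V. \<Sum>k<d. (if w = a then g k else 0) * q (w, k))"
      unfolding sum.cartesian_product by (rule sum.cong) auto
    also have "\<dots> = (\<Sum>w\<in>V. if w = a then (\<Sum>k<d. g k * q (a, k)) else 0)"
      by (rule sum.cong) auto
    finally show ?thesis using that V by simp
  qed
  have row1: "(\<Sum>i\<in>?I. \<alpha> (Inl (a, b)) i x * q i) = (\<Sum>k<d. \<delta> x (a, b) k * (q (a, k) - q (b, k)))"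
    if "(a, b) \<in> E" for a b x q
  proof -
    have "(\<Sum>i\<in>?I. \<alpha> (Inl (a, b)) i x * q i)
      = (\<Sum>i\<in>?I. (case i of (w, k) \<Rightarrow> if w = a then \<delta> x (a, b) k else 0) * q i)
      - (\<Sum>i\<in>?I. (case i of (w, k) \<Rightarrow> if w = b then \<delta> x (a, b) k else 0) * q i)"
      unfolding \<alpha>_def sum_subtractf[symmetric] by (rule sum.cong) (auto simp: algebra_simps)
    also have "\<dots> = (\<Sum>k<d. \<delta> x (a, b) k * q (a, k)) - (\<Sum>k<d. \<delta> x (a, b) k * q (b, k))"
      using that E by (subst (1 2) delta) auto
    finally show ?thesis by (simp add: sum_subtractf algebra_simps)
  qed
  have row2: "(\<Sum>i\<in>?I. \<alpha> (Inr (f, l)) i x * q i) = q (f, l)" if "f \<in> F" "l < d" for f l x q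
  proof -
    have "(\<Sum>i\<in>?I. \<alpha> (Inr (f, l)) i x * q i) = (\<Sum>k<d. (if k = l then 1 else 0) * q (f, k))"
      unfolding delta[OF subsetD[OF F that(1)], of "\<lambda>k. if k = l then 1 else 0" q, symmetric] \<alpha>_def
      by (rule sum.cong) auto
    also have "\<dots> = (\<Sum>k<d. if k = l then q (f, k) else 0)" by (rule sum.cong) auto
    finally show ?thesis using that by simp
  qed
  show thesis
  proof (rule that)
    fix \<gamma> assume \<gamma>: "\<And>e k. e \<in> E \<Longrightarrow> poly_along \<gamma> (\<lambda>x. \<delta> x e k)"
    show "poly_along \<gamma> D"
    proof (rule D(1))
      fix j i assume "j \<in> ?J"
      then show "poly_along \<gamma> (\<alpha> j i)"
      proof (elim PlusE)
        fix e assume "e \<in> E" "j = Inl e"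
        then show ?thesis
          unfolding \<alpha>_def
          by (cases e; cases i) (auto intro!: poly_along_diff poly_along_if poly_along_const \<gamma>)
      next
        fix e assume "j = Inr e"
        then show ?thesis unfolding \<alpha>_def by (cases e; cases i) auto
      qed
    qed
  next
    fix x
    have ball_Plus: "(\<forall>j\<in>A <+> B. Q j) \<longleftrightarrow> (\<forall>a\<in>A. Q (Inl a)) \<and> (\<forall>b\<in>B. Q (Inr b))" for A B Q
      by auto
    have rows: "(\<forall>j\<in>?J. (\<Sum>i\<in>?I. \<alpha> j i x * q i) = 0) \<longleftrightarrow>
        (\<forall>(a, b)\<in>E. (\<Sum>k<d. \<delta> x (a, b) k * (q (a, k) - q (b, k))) = 0) \<and>
        (\<forall>f\<in>F. \<forall>k<d. q (f, k) = 0)" for q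
      unfolding ball_Plus using row1 row2 by auto
    show "D x \<noteq> 0 \<longleftrightarrow> (\<forall>q. (\<forall>(a, b)\<in>E. (\<Sum>k<d. \<delta> x (a, b) k * (q a k - q b k)) = 0) \<and>
       (\<forall>f\<in>F. \<forall>k<d. q f k = 0) \<longrightarrow> (\<forall>v\<in>V. \<forall>k<d. q v k = 0))"
      unfolding D(2) rows
    proof (intro iffI allI impI)
      fix q :: "'v \<Rightarrow> nat \<Rightarrow> real"
      assume *: "\<forall>q. (\<forall>(a, b)\<in>E. (\<Sum>k<d. \<delta> x (a, b) k * (q (a, k) - q (b, k))) = 0) \<and>
        (\<forall>f\<in>F. \<forall>k<d. q (f, k) = 0) \<longrightarrow> (\<forall>i\<in>?I. q i = 0)"
        and q: "(\<forall>(a, b)\<in>E. (\<Sum>k<d. \<delta> x (a, b) k * (q a k - q b k)) = 0) \<and>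
       (\<forall>f\<in>F. \<forall>k<d. q f k = 0)"
      have "\<forall>i\<in>?I. (case i of (v, k) \<Rightarrow> q v k) = 0"
        by (rule mp[OF spec[OF *]]) (use q in simp)
      then show "\<forall>v\<in>V. \<forall>k<d. q v k = 0" by simp
    next
      fix q :: "'v \<times> nat \<Rightarrow> real"
      assume *: "\<forall>q. (\<forall>(a, b)\<in>E. (\<Sum>k<d. \<delta> x (a, b) k * (q a k - q b k)) = 0) \<and>
       (\<forall>f\<in>F. \<forall>k<d. q f k = 0) \<longrightarrow> (\<forall>v\<in>V. \<forall>k<d. q v k = 0)"
        and q: "(\<forall>(a, b)\<in>E. (\<Sum>k<d. \<delta> x (a, b) k * (q (a, k) - q (b, k))) = 0) \<and>
        (\<forall>f\<in>F. \<forall>k<d. q (f, k) = 0)"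
      have "\<forall>v\<in>V. \<forall>k<d. q (v, k) = 0"
        by (rule mp[OF spec[OF *]]) (rule q)
      then show "\<forall>i\<in>?I. q i = 0" by auto
    qed
  qed
qed

lemma generic_pinned:
  assumes V: "finite V" "E \<subseteq> V \<times> V" "F \<subseteq> V" and "pinned V E F (sparsify x0)"
  shows "generic (\<lambda>x. pinned V E F (sparsify x))"
proof -
  define \<delta> where "\<delta> x e k = sparsify x (fst e) k - sparsify x (snd e) k" for x and e :: "'v \<times> 'v" and k
  obtain D where D: "\<And>\<gamma>. (\<And>e k. e \<in> E \<Longrightarrow> poly_along \<gamma> (\<lambda>x. \<delta> x e k)) \<Longrightarrow> poly_along \<gamma> D"
    "\<And>x. D x \<noteq> 0 \<longleftrightarrow> (\<forall>q. (\<forall>(a, b)\<in>E. (\<Sum>k<d. \<delta> x (a, b) k * (q a k - q b k)) = 0) \<and>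
       (\<forall>f\<in>F. \<forall>k<d. q f k = 0) \<longrightarrow> (\<forall>v\<in>V. \<forall>k<d. q v k = 0))"
    by (rule pinned_discriminant[OF V, of \<delta>]) blast
  have "D x \<noteq> 0 \<longleftrightarrow> pinned V E F (sparsify x)" for x
    unfolding D(2) pinned_def motion_def \<delta>_def by simp
  moreover have "poly_along (line p q) D" for p q
    by (rule D(1)) (auto simp: \<delta>_def intro: poly_along_sparsify)
  ultimately show ?thesis unfolding generic_def using assms(4) by blast
qed

text \<open>With z = p a - p b, the linear part of the trivial motion contributes the quadratic form
  of S at z, which is 0 for skew S; the translation cancels.\<close>

lemma motion_diff_trivial:
  assumes "motion E p q" "skew S"
    and "\<And>v k. k < d \<Longrightarrow> q' v k = q v k - ((\<Sum>l<d. S k l * p v l) + t k)"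
  shows "motion E p q'"
proof -
  have "(\<Sum>k<d. (p a k - p b k) * (q' a k - q' b k)) = 0" if "(a, b) \<in> E" for a b
  proof -
    define z where "z k = p a k - p b k" for k
    have *: "(p a k - p b k) * (q' a k - q' b k) =
        (p a k - p b k) * (q a k - q b k) - (\<Sum>l<d. z k * S k l * z l)" if "k < d" for k
      unfolding assms(3)[OF that] z_def
      by (simp add: algebra_simps sum_subtractf sum.distrib sum_distrib_left)
    have "(\<Sum>k<d. \<Sum>l<d. z k * S k l * z l) = (\<Sum>k<d. \<Sum>l<d. - (z l * S l k * z k))"
    proof (intro sum.cong refl)
      fix k l assume "k \<in> {..<d}" "l \<in> {..<d}"
      then have "S k l = - S l k" using assms(2) unfolding skew_def by blast
      then show "z k * S k l * z l = - (z l * S l k * z k)" by (simp only: mult_ac mult_minus_left mult_minus_right)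
    qed
    also have "\<dots> = - (\<Sum>k<d. \<Sum>l<d. z k * S k l * z l)"
      by (subst sum.swap) (simp add: sum_negf)
    finally have "(\<Sum>k<d. \<Sum>l<d. z k * S k l * z l) = 0" by simp
    moreover have "(\<Sum>k<d. (p a k - p b k) * (q a k - q b k)) = 0"
      using assms(1) that unfolding motion_def by blast
    ultimately show ?thesis using * by (simp add: sum_subtractf)
  qed
  then show ?thesis unfolding motion_def by blast
qed

text \<open>The translation \<open>t\<close> is chosen so that the bilinear form \<open>p f \<bullet> (q g - t)\<close> on \<open>F\<close> is
  skew; transporting this form along the dual basis \<open>r\<close> yields \<open>S\<close>.\<close>

lemma clique_motion_trivial:
  assumes F: "finite F" "card F = d" "F \<times> F \<subseteq> E" and p: "spanning F p" and q: "motion E p q"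
  obtains S t where "skew S" "\<And>v k. v \<in> F \<Longrightarrow> k < d \<Longrightarrow> q v k = (\<Sum>l<d. S k l * p v l) + t k"
proof -
  obtain r where r1: "\<And>i j. i \<in> F \<Longrightarrow> j \<in> F \<Longrightarrow> (\<Sum>k<d. r i k * p j k) = (if i = j then 1 else 0)"
    and r2: "\<And>k l. k < d \<Longrightarrow> l < d \<Longrightarrow> (\<Sum>i\<in>F. r i k * p i l) = (if k = l then 1 else 0)"
    by (rule square_system_dual[OF F(1,2), of p])
      (use p in \<open>auto simp: spanning_def mult.commute\<close>)
  define t where "t k = (\<Sum>f\<in>F. r f k * (\<Sum>l<d. p f l * q f l))" for k
  define X where "X f g = (\<Sum>l<d. p f l * (q g l - t l))" for f g
  define S where "S k l = (\<Sum>f\<in>F. \<Sum>g\<in>F. r f k * X f g * r g l)" for k l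
  have t: "(\<Sum>k<d. p f k * t k) = (\<Sum>l<d. p f l * q f l)" if "f \<in> F" for f
  proof -
    have "(\<Sum>k<d. p f k * t k) = (\<Sum>k<d. \<Sum>g\<in>F. (r g k * p f k) * (\<Sum>l<d. p g l * q g l))"
      unfolding t_def by (simp add: sum_distrib_left ac_simps)
    also have "\<dots> = (\<Sum>g\<in>F. (\<Sum>k<d. r g k * p f k) * (\<Sum>l<d. p g l * q g l))"
      by (subst sum.swap) (simp add: sum_distrib_right)
    also have "\<dots> = (\<Sum>g\<in>F. if g = f then (\<Sum>l<d. p g l * q g l) else 0)"
      using that by (intro sum.cong) (auto simp: r1)
    finally show ?thesis using that F(1) by simp
  qed
  have X: "X f g = - X g f" if "f \<in> F" "g \<in> F" for f g
  proof -
    have "(\<Sum>k<d. (p f k - p g k) * (q f k - q g k)) = 0"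
      using q F(3) that unfolding motion_def by blast
    then have "(\<Sum>k<d. p f k * q f k) + (\<Sum>k<d. p g k * q g k) = (\<Sum>k<d. p f k * q g k) + (\<Sum>k<d. p g k * q f k)"
      by (simp add: algebra_simps sum.distrib sum_subtractf)
    then show ?thesis
      unfolding X_def using t[OF that(1)] t[OF that(2)] by (simp add: algebra_simps sum_subtractf)
  qed
  have "skew S"
    unfolding skew_def
  proof (intro allI impI)
    fix k l
    have "S k l = (\<Sum>f\<in>F. \<Sum>g\<in>F. - (r g l * X g f * r f k))"
      unfolding S_def
    proof (intro sum.cong refl)
      fix f g assume "f \<in> F" "g \<in> F"
      then have "X f g = - X g f" by (rule X)
      then show "r f k * X f g * r g l = - (r g l * X g f * r f k)"
        by (simp only: mult_ac mult_minus_left mult_minus_right)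
    qed
    also have "\<dots> = - S l k" unfolding S_def by (subst sum.swap) (simp add: sum_negf)
    finally show "S k l = - S l k" .
  qed
  moreover have "q v k = (\<Sum>l<d. S k l * p v l) + t k" if v: "v \<in> F" and k: "k < d" for v k
  proof -
    have "(\<Sum>l<d. S k l * p v l) = (\<Sum>l<d. \<Sum>f\<in>F. \<Sum>g\<in>F. r f k * X f g * (r g l * p v l))"
      unfolding S_def by (simp add: sum_distrib_right mult.assoc)
    also have "\<dots> = (\<Sum>f\<in>F. \<Sum>l<d. \<Sum>g\<in>F. r f k * X f g * (r g l * p v l))" by (rule sum.swap)
    also have "\<dots> = (\<Sum>f\<in>F. \<Sum>g\<in>F. \<Sum>l<d. r f k * X f g * (r g l * p v l))"
      by (intro sum.cong refl sum.swap)
    also have "\<dots> = (\<Sum>f\<in>F. \<Sum>g\<in>F. r f k * X f g * (\<Sum>l<d. r g l * p v l))"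
      by (simp add: sum_distrib_left)
    also have "\<dots> = (\<Sum>f\<in>F. \<Sum>g\<in>F. if g = v then r f k * X f v else 0)"
      using v by (intro sum.cong refl) (simp add: r1)
    also have "\<dots> = (\<Sum>f\<in>F. r f k * X f v)" using v F(1) by simp
    also have "\<dots> = (\<Sum>l<d. \<Sum>f\<in>F. (r f k * p f l) * (q v l - t l))"
      unfolding X_def by (subst sum.swap) (simp add: sum_distrib_left mult.assoc)
    also have "\<dots> = (\<Sum>l<d. (\<Sum>f\<in>F. r f k * p f l) * (q v l - t l))"
      by (simp add: sum_distrib_right)
    also have "\<dots> = (\<Sum>l<d. if l = k then q v l - t l else 0)"
      using k by (intro sum.cong refl) (simp add: r2)
    also have "\<dots> = q v k - t k" using k by simp
    finally show ?thesis by simp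
  qed
  ultimately show thesis by (rule that)
qed

text \<open>Any motion agrees on the clique \<open>F\<close> with a trivial one. After subtracting
  it, the motion is pinned on \<open>F\<close>.\<close>

lemma rigid_of_pinned:
  assumes F: "finite F" "card F = d" "F \<times> F \<subseteq> E" and "spanning F p" and pin: "pinned V E F p"
  shows "rigid V E p"
  unfolding rigid_def
proof (intro allI impI)
  fix q assume q: "motion E p q"
  obtain S t where S: "skew S"
    and St: "\<And>v k. v \<in> F \<Longrightarrow> k < d \<Longrightarrow> q v k = (\<Sum>l<d. S k l * p v l) + t k"
    using clique_motion_trivial[OF F assms(4) q] by blast
  define q' where "q' v k = q v k - ((\<Sum>l<d. S k l * p v l) + t k)" for v k
  have "motion E p q'" by (rule motion_diff_trivial[OF q S]) (rule q'_def)
  moreover have "\<forall>f\<in>F. \<forall>k<d. q' f k = 0" unfolding q'_def using St by simp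
  ultimately have "\<forall>v\<in>V. \<forall>k<d. q' v k = 0" using pin unfolding pinned_def by blast
  then have "\<forall>v\<in>V. \<forall>k<d. q v k = (\<Sum>l<d. S k l * p v l) + t k" unfolding q'_def by simp
  with S show "\<exists>S t. skew S \<and> (\<forall>v\<in>V. \<forall>k<d. q v k = (\<Sum>l<d. S k l * p v l) + t k)" by blast
qed

text \<open>The gluing principle: on a rigid part the motion is trivial, and a trivial motion that
  vanishes on a nondegenerate set is 0.\<close>

lemma rigid_motion_zero:
  assumes "rigid V E p" "motion E p q" "nondeg F p" "F \<subseteq> V"
    and "\<And>f k. f \<in> F \<Longrightarrow> k < d \<Longrightarrow> q f k = 0" and "v \<in> V" "k < d"
  shows "q v k = 0"
proof -
  have "\<exists>S t. skew S \<and> (\<forall>v\<in>V. \<forall>k<d. q v k = (\<Sum>l<d. S k l * p v l) + t k)"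
    using assms(1,2) unfolding rigid_def by simp
  then obtain S t where S: "skew S" and St: "\<forall>v\<in>V. \<forall>k<d. q v k = (\<Sum>l<d. S k l * p v l) + t k"
    by (elim exE conjE)
  have "\<forall>f\<in>F. \<forall>k<d. (\<Sum>l<d. S k l * p f l) + t k = 0"
  proof (intro ballI allI impI)
    fix f k assume "f \<in> F" "k < d"
    then show "(\<Sum>l<d. S k l * p f l) + t k = 0"
      using St assms(4) assms(5)[of f k] by (metis subsetD)
  qed
  then have "\<forall>k<d. t k = 0 \<and> (\<forall>l<d. S k l = 0)"
    using assms(3) S unfolding nondeg_def by simp
  then show ?thesis using St assms(6,7) by simp
qed

lemma generic_rigid_simplex:
  assumes "finite F" "card F = d" "fits \<phi> F" "F \<times> F \<subseteq> E"
  shows "generic (\<lambda>x. rigid F E (sparsify x))"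
  by (rule generic_mono[OF generic_spanning[OF assms(1-3)]])
    (rule rigid_of_pinned[OF assms(1,2,4)], auto simp: pinned_def)

text \<open>On the curve that sends \<open>u\<close> to \<open>x v + t * x u\<close>, the row of the edge \<open>{u, v}\<close> is divisible
  by \<open>t\<close>. After dividing, the limit \<open>t = 0\<close> forces equal velocities at \<open>u\<close> and \<open>v\<close>.\<close>

lemma generic_rigid_split:
  fixes u v :: 'v
  defines "\<pi> \<equiv> \<lambda>w. if w = u then v else w"
  assumes V: "finite V" "E \<subseteq> V \<times> V" and uv: "u \<noteq> v" "\<kappa> u = \<kappa> v" "(u, v) \<in> E"
    and V': "\<pi> ` V \<subseteq> V'" and E': "\<And>a b. (a, b) \<in> E' \<Longrightarrow> \<exists>(a', b')\<in>E. a = \<pi> a' \<and> b = \<pi> b'"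
    and W: "u \<notin> W" "v \<notin> W" "\<And>w. w \<in> W \<Longrightarrow> (u, w) \<in> E \<and> (v, w) \<in> E"
    and split: "generic (\<lambda>x. splitting W u v (sparsify x))"
    and F: "F \<subseteq> V" "card F = d" "F \<times> F \<subseteq> E"
    and span: "generic (\<lambda>x. spanning F (sparsify x))"
    and nd: "generic (\<lambda>x. nondeg (\<pi> ` F) (sparsify x))"
    and rig': "generic (\<lambda>x. rigid V' E' (sparsify x))"
  shows "generic (\<lambda>x. rigid V E (sparsify x))"
proof -
  obtain x where x: "splitting W u v (sparsify x)" "nondeg (\<pi> ` F) (sparsify x)" "rigid V' E' (sparsify x)"
    using generic_exists[OF generic_conj[OF split generic_conj[OF nd rig']]] by (elim exE conjE)
  define pt where "pt t = x(u := \<lambda>k. x v k + t * x u k)" for t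
  have pt: "sparsify (pt t) a k = (if a = u then sparsify x v k + t * sparsify x u k else sparsify x a k)" for t a k
    unfolding sparsify_def pt_def using uv by simp
  define \<delta> where "\<delta> t e k = (if e = (u, v) then sparsify x u k else if e = (v, u) then - sparsify x u k
      else sparsify (pt t) (fst e) k - sparsify (pt t) (snd e) k)" for t e k
  obtain D where D: "\<And>\<gamma>. (\<And>e k. e \<in> E \<Longrightarrow> poly_along \<gamma> (\<lambda>x. \<delta> x e k)) \<Longrightarrow> poly_along \<gamma> D"
    "\<And>x. D x \<noteq> 0 \<longleftrightarrow> (\<forall>q. (\<forall>(a, b)\<in>E. (\<Sum>k<d. \<delta> x (a, b) k * (q a k - q b k)) = 0) \<and>
       (\<forall>f\<in>F. \<forall>k<d. q f k = 0) \<longrightarrow> (\<forall>v\<in>V. \<forall>k<d. q v k = 0))"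
    by (rule pinned_discriminant[OF V F(1), of \<delta>]) blast
  have "poly_along (\<lambda>t. t) (\<lambda>t. t)"
    unfolding poly_along_def by (rule exI[of _ "[:0, 1:]"]) simp
  then have poly: "poly_along (\<lambda>t. t) (\<lambda>t. \<delta> t e k)" for e k
    unfolding \<delta>_def pt
    by (intro poly_along_if poly_along_diff poly_along_add poly_along_mult poly_along_const)
  \<comment> \<open>At t = 0 the vertex \<open>u\<close> sits on \<open>v\<close>. Once
    \<open>u\<close> and \<open>v\<close> are known to have equal velocities, \<open>q\<close> is a
    motion of the contracted framework, vanishing on the nondegenerate image of
    \<open>F\<close>.\<close>
  have "D 0 \<noteq> 0"
    unfolding D(2)
  proof (intro allI impI ballI, elim conjE)
    fix q assume q: "\<forall>(a, b)\<in>E. (\<Sum>k<d. \<delta> 0 (a, b) k * (q a k - q b k)) = 0"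
      and qF: "\<forall>f\<in>F. \<forall>k<d. q f k = 0"
    have "(\<Sum>k<d. (sparsify x v k - sparsify x w k) * (q u k - q v k)) = 0" if "w \<in> W" for w
    proof -
      have "w \<noteq> u" "w \<noteq> v" using W that by auto
      then have "(\<Sum>k<d. (sparsify x v k - sparsify x w k) * (q u k - q w k)) = 0"
        "(\<Sum>k<d. (sparsify x v k - sparsify x w k) * (q v k - q w k)) = 0"
        using bspec[OF q W(3)[OF that, THEN conjunct1]] bspec[OF q W(3)[OF that, THEN conjunct2]] uv(1)
        unfolding \<delta>_def pt by auto
      then show ?thesis by (simp add: algebra_simps sum.distrib sum_subtractf)
    qed
    moreover have "(\<Sum>k<d. sparsify x u k * (q u k - q v k)) = 0"
      using bspec[OF q uv(3)] unfolding \<delta>_def by simp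
    ultimately have quv: "\<forall>k<d. q u k = q v k"
      using x(1) unfolding splitting_def
      by (auto dest!: spec[of _ "\<lambda>k. q u k - q v k"])
    then have q\<pi>: "q (\<pi> a) k = q a k" if "k < d" for a k using that unfolding \<pi>_def by simp
    have mot: "motion E' (sparsify x) q"
      unfolding motion_def
    proof (intro ballI, clarify)
      fix a b assume "(a, b) \<in> E'"
      from E'[OF this] obtain a' b' where ab: "(a', b') \<in> E" "a = \<pi> a'" "b = \<pi> b'"
        by auto
      show "(\<Sum>k<d. (sparsify x a k - sparsify x b k) * (q a k - q b k)) = 0"
      proof (cases "(a', b') = (u, v) \<or> (a', b') = (v, u)")
        case True
        then show ?thesis using ab unfolding \<pi>_def by auto
      next
        case False
        have "(\<Sum>k<d. \<delta> 0 (a', b') k * (q a' k - q b' k)) = 0"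
          using bspec[OF q ab(1)] by (simp only: prod.case)
        moreover have "\<delta> 0 (a', b') k = sparsify (pt 0) a' k - sparsify (pt 0) b' k" for k
          unfolding \<delta>_def using False by (simp only: de_Morgan_disj if_False fst_conv snd_conv)
        moreover have "sparsify (pt 0) c k = sparsify x (\<pi> c) k" for c k by (simp add: pt \<pi>_def)
        ultimately show ?thesis unfolding ab by (simp add: q\<pi>)
      qed
    qed
    have "\<pi> ` F \<subseteq> V'" using F(1) V' by blast
    moreover have "q f k = 0" if "f \<in> \<pi> ` F" "k < d" for f k
      using that qF q\<pi>[OF that(2)] by (elim imageE) simp
    ultimately have q0: "q a k = 0" if "a \<in> V'" "k < d" for a k
      using rigid_motion_zero[OF x(3) mot x(2) _ _ that] by simp
    fix a k assume "a \<in> V" "k < d"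
    then show "q a k = 0" using q\<pi>[of k a] q0[of "\<pi> a" k] V' by auto
  qed
  then have "finite {t. D t = 0}"
    using poly_along_finite_zeros[of "\<lambda>t. t" D 0] D(1) poly by blast
  then have "finite (insert 0 {t. D t = 0})" by simp
  \<comment> \<open>Besides \<open>D t \<noteq> 0\<close>, a nonzero \<open>t\<close> is wanted: for
    it the true row of the edge \<open>{u, v}\<close> and its quotient by \<open>t\<close> impose
    the same condition.\<close>
  then obtain t where t: "t \<noteq> 0" "D t \<noteq> 0"
    using ex_new_if_finite[OF infinite_UNIV_char_0] by blast
  have "pinned V E F (sparsify (pt t))"
    unfolding pinned_def
  proof (intro allI impI, elim conjE)
    fix q assume q: "motion E (sparsify (pt t)) q" and qF: "\<forall>f\<in>F. \<forall>k<d. q f k = 0"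
    have "(\<Sum>k<d. \<delta> t (a, b) k * (q a k - q b k)) = 0" if "(a, b) \<in> E" for a b
    proof -
      have m: "(\<Sum>k<d. (sparsify (pt t) a k - sparsify (pt t) b k) * (q a k - q b k)) = 0"
        using bspec[OF q[unfolded motion_def] that] by (simp only: prod.case)
      show ?thesis
      proof (cases "(a, b) = (u, v) \<or> (a, b) = (v, u)")
        case True
        then have "(sparsify (pt t) a k - sparsify (pt t) b k) * (q a k - q b k) = t * (\<delta> t (a, b) k * (q a k - q b k))" for k
          using uv unfolding \<delta>_def pt by (auto simp: algebra_simps)
        then have "t * (\<Sum>k<d. \<delta> t (a, b) k * (q a k - q b k)) = 0"
          using m by (simp only: sum_distrib_left)
        with t show ?thesis by simp
      next
        case False
        then show ?thesis using m unfolding \<delta>_def by auto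
      qed
    qed
    then have "\<forall>(a, b)\<in>E. (\<Sum>k<d. \<delta> t (a, b) k * (q a k - q b k)) = 0" by blast
    with qF show "\<forall>v\<in>V. \<forall>k<d. q v k = 0" using t(2)[unfolded D(2)] by simp
  qed
  then have "generic (\<lambda>x. pinned V E F (sparsify x))" by (rule generic_pinned[OF V F(1)])
  from generic_conj[OF span this] show ?thesis
    by (rule generic_mono) (use F rigid_of_pinned V(1) finite_subset in blast)
qed

end

section \<open>Chains and edge contraction\<close>

text \<open>Signs are Booleans, so the coefficient group needs no scalars: a product of signs is an
  equality of Booleans and a change of sign is a negation.\<close>

definition signed :: "bool \<Rightarrow> 'g::ab_group_add \<Rightarrow> 'g" where
  "signed b x = (if b then x else - x)"

definition even_pos :: "'v::linorder \<Rightarrow> 'v set \<Rightarrow> bool" where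
  "even_pos x G \<longleftrightarrow> even (card {y \<in> G. y < x})"

text \<open>With positions counted from 0, the signs are opposite to those of \<^const>\<open>boundary\<close>.\<close>

definition bdry :: "'v::linorder set \<Rightarrow> ('v set \<Rightarrow> 'g::ab_group_add) \<Rightarrow> 'v set \<Rightarrow> 'g" where
  "bdry V c G = (\<Sum>x\<in>V - G. signed (even_pos x G) (c (insert x G)))"

definition is_cycle :: "'v::linorder set \<Rightarrow> ('v set \<Rightarrow> 'g::ab_group_add) \<Rightarrow> bool" where
  "is_cycle V c \<longleftrightarrow> (\<forall>G\<subseteq>V. bdry V c G = 0)"

definition supp :: "('v set \<Rightarrow> 'g::zero) \<Rightarrow> 'v set set" where
  "supp c = {F. c F \<noteq> 0}"

definition restrict :: "('v set \<Rightarrow> 'g::zero) \<Rightarrow> 'v set set \<Rightarrow> 'v set \<Rightarrow> 'g" where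
  "restrict c A F = (if F \<in> A then c F else 0)"

text \<open>A subchain is determined by the faces it keeps, so minimality can range over subsets of
  the support. Dimension enters separately, through \<open>saturated\<close>.\<close>

definition is_min_cycle :: "'v::linorder set \<Rightarrow> ('v set \<Rightarrow> 'g::ab_group_add) \<Rightarrow> bool" where
  "is_min_cycle V c \<longleftrightarrow> supp c \<subseteq> Pow V \<and> is_cycle V c \<and>
     (\<forall>A\<subseteq>supp c. is_cycle V (restrict c A) \<longrightarrow> A = {} \<or> A = supp c)"

lemma signed_simps [simp]:
  "signed b 0 = 0" "signed b (- x) = - signed b x" "signed (\<not> b) x = - signed b x"
  "signed b (signed b' x) = signed (b = b') x" "signed b x = 0 \<longleftrightarrow> x = 0"
  unfolding signed_def by auto

lemma signed_add: "signed b (x + y) = signed b x + signed b y"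
  unfolding signed_def by simp

lemma signed_sum: "signed b (sum f A) = (\<Sum>x\<in>A. signed b (f x))"
  unfolding signed_def by (simp add: sum_negf)

lemma signed_neq: "b \<noteq> b' \<Longrightarrow> signed b x = - signed b' x"
  unfolding signed_def by auto

lemma even_pos_insert: "finite G \<Longrightarrow> y \<notin> G \<Longrightarrow> even_pos x (insert y G) \<longleftrightarrow> even_pos x G = (\<not> y < x)"
proof -
  assume G: "finite G" "y \<notin> G"
  have "{z \<in> insert y G. z < x} = (if y < x then insert y {z \<in> G. z < x} else {z \<in> G. z < x})"
    by auto
  then show ?thesis unfolding even_pos_def using G by simp
qed

lemma bdry_add: "bdry V (\<lambda>F. f F + g F) G = bdry V f G + bdry V g G"
  unfolding bdry_def by (simp add: signed_add sum.distrib)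

text \<open>Inserting x and y in either order gives the same face with opposite signs. In a group
  with 2-torsion this antisymmetry alone would only show that twice the sum is 0; hence the split
  into y < x and x < y, whose sums cancel.\<close>

lemma bdry_bdry:
  assumes V: "finite V" and G: "G \<subseteq> V"
  shows "(\<Sum>x\<in>V - G. signed (even_pos x G) (bdry V c (insert x G))) = 0"
proof -
  define U where "U = V - G"
  define T where "T x y = signed (even_pos x G) (signed (even_pos y (insert x G)) (c (insert y (insert x G))))" for x y
  have fin: "finite U" "finite G" using V G finite_subset unfolding U_def by auto
  have T: "T y x = - T x y" if "x \<in> U" "y \<in> U" "x \<noteq> y" for x y
  proof -
    have "(even_pos y G = even_pos x (insert y G)) \<noteq> (even_pos x G = even_pos y (insert x G))"
      using that fin(2) unfolding U_def by (auto simp: even_pos_insert)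
    moreover have "insert x (insert y G) = insert y (insert x G)" by auto
    ultimately show ?thesis unfolding T_def by (simp only: signed_simps signed_neq)
  qed
  have "(\<Sum>x\<in>V - G. signed (even_pos x G) (bdry V c (insert x G))) = (\<Sum>x\<in>U. \<Sum>y\<in>U - {x}. T x y)"
  proof (rule sum.cong)
    fix x assume "x \<in> U"
    have "V - insert x G = U - {x}" unfolding U_def by auto
    then show "signed (even_pos x G) (bdry V c (insert x G)) = (\<Sum>y\<in>U - {x}. T x y)"
      unfolding bdry_def T_def by (simp only: signed_sum)
  qed (simp add: U_def)
  also have "\<dots> = (\<Sum>x\<in>U. (\<Sum>y | y \<in> U \<and> y < x. T x y) + (\<Sum>y | y \<in> U \<and> x < y. T x y))"
  proof (rule sum.cong)
    fix x assume "x \<in> U"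
    have "U - {x} = {y. y \<in> U \<and> y < x} \<union> {y. y \<in> U \<and> x < y}" by auto
    moreover have "sum (T x) ({y. y \<in> U \<and> y < x} \<union> {y. y \<in> U \<and> x < y}) =
        (\<Sum>y | y \<in> U \<and> y < x. T x y) + (\<Sum>y | y \<in> U \<and> x < y. T x y)"
      using fin by (intro sum.union_disjoint) auto
    ultimately show "(\<Sum>y\<in>U - {x}. T x y) =
        (\<Sum>y | y \<in> U \<and> y < x. T x y) + (\<Sum>y | y \<in> U \<and> x < y. T x y)" by simp
  qed simp
  also have "\<dots> = (\<Sum>x\<in>U. \<Sum>y | y \<in> U \<and> y < x. T x y) + (\<Sum>x\<in>U. \<Sum>y | y \<in> U \<and> x < y. T x y)"
    by (rule sum.distrib)
  also have "(\<Sum>x\<in>U. \<Sum>y | y \<in> U \<and> x < y. T x y) = (\<Sum>y\<in>U. \<Sum>x | x \<in> U \<and> x < y. T x y)"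
    using fin by (intro sum.swap_restrict) auto
  also have "\<dots> = (\<Sum>y\<in>U. \<Sum>x | x \<in> U \<and> x < y. - T y x)"
    by (intro sum.cong refl T) auto
  finally show ?thesis by (simp add: sum_negf)
qed

section \<open>Contraction of an edge and filling\<close>

locale contraction =
  fixes V :: "'v::linorder set" and u v :: 'v
  assumes V: "finite V" and uV: "u \<in> V" and vV: "v \<in> V" and uv: "u \<noteq> v"
begin

definition \<pi> :: "'v set \<Rightarrow> 'v set" where
  "\<pi> F = (if u \<in> F then insert v (F - {u}) else F)"

text \<open>The sign is that of replacing \<open>u\<close> by \<open>v\<close> in an oriented face.\<close>

definition contr :: "('v set \<Rightarrow> 'g::ab_group_add) \<Rightarrow> 'v set \<Rightarrow> 'g" where
  "contr f G = (if u \<in> G then 0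
     else if v \<in> G then
       f G + signed (even_pos u (G - {v}) = even_pos v (G - {v})) (f (insert u (G - {v})))
     else f G)"

text \<open>The coefficients on faces containing \<open>u\<close> and \<open>v\<close> are the ones that cancel the boundary on
  faces containing \<open>u\<close> but not \<open>v\<close>.\<close>

definition fill :: "('v set \<Rightarrow> 'g::ab_group_add) \<Rightarrow> 'v set \<Rightarrow> 'g" where
  "fill f F = (if u \<in> F \<and> v \<in> F \<and> F \<subseteq> V
     then - signed (even_pos v (F - {v})) (bdry V f (F - {v})) else f F)"

definition avoids_uv :: "('v set \<Rightarrow> 'g::zero) \<Rightarrow> bool" where
  "avoids_uv f \<longleftrightarrow> (\<forall>F. u \<in> F \<longrightarrow> v \<in> F \<longrightarrow> f F = 0)"

lemma contr_add: "contr (\<lambda>F. f F + g F) G = contr f G + contr g G"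
  unfolding contr_def by (simp add: signed_add)

lemma fin: "G \<subseteq> V \<Longrightarrow> finite G"
  using V finite_subset by blast

lemma bdry_split:
  assumes "G \<subseteq> V" "u \<notin> G" "v \<notin> G"
  shows "bdry V f G = signed (even_pos u G) (f (insert u G)) + signed (even_pos v G) (f (insert v G))
    + (\<Sum>x\<in>V - G - {u, v}. signed (even_pos x G) (f (insert x G)))"
proof -
  have "V - G = insert u (insert v (V - G - {u, v}))" using assms uV vV by auto
  moreover have "finite (V - G - {u, v})" using V by simp
  ultimately show ?thesis unfolding bdry_def using uv
    by (metis (no_types, lifting) Diff_iff add.assoc insertCI insertE sum.insert finite_insert)
qed

lemma bdry_split_u:
  assumes "K \<subseteq> V" "u \<notin> K" "v \<notin> K"
  shows "bdry V f (insert u K) = signed (even_pos v (insert u K)) (f (insert v (insert u K)))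
    + (\<Sum>x\<in>V - K - {u, v}. signed (even_pos x (insert u K)) (f (insert x (insert u K))))"
proof -
  have "V - insert u K = insert v (V - K - {u, v})" using assms vV uv by auto
  moreover have "finite (V - K - {u, v})" using V by simp
  ultimately show ?thesis unfolding bdry_def by simp
qed

lemma bdry_split_v:
  assumes "K \<subseteq> V" "u \<notin> K" "v \<notin> K"
  shows "bdry V f (insert v K) = signed (even_pos u (insert v K)) (f (insert u (insert v K)))
    + (\<Sum>x\<in>V - K - {u, v}. signed (even_pos x (insert v K)) (f (insert x (insert v K))))"
proof -
  have "V - insert v K = insert u (V - K - {u, v})" using assms uV uv by auto
  moreover have "finite (V - K - {u, v})" using V by simp
  ultimately show ?thesis unfolding bdry_def by simp
qed

text \<open>Together with \<open>bdry_contr_on\<close> and \<open>bdry_contr_u\<close> this says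
  that \<open>contr\<close> commutes with the boundary on chains that avoid the edge
  \<open>{u, v}\<close>.\<close>

lemma bdry_contr_off:
  assumes "G \<subseteq> V" "u \<notin> G" "v \<notin> G"
  shows "bdry V (contr f) G = bdry V f G"
proof -
  have "(\<Sum>x\<in>V - G - {u, v}. signed (even_pos x G) (contr f (insert x G))) =
      (\<Sum>x\<in>V - G - {u, v}. signed (even_pos x G) (f (insert x G)))"
    by (rule sum.cong) (use assms in \<open>auto simp: contr_def\<close>)
  moreover have "contr f (insert u G) = 0" unfolding contr_def by simp
  moreover have "contr f (insert v G) = f (insert v G) + signed (even_pos u G = even_pos v G) (f (insert u G))"
    unfolding contr_def using assms uv by simp
  moreover have "(even_pos v G = (even_pos u G = even_pos v G)) = even_pos u G" by blast
  ultimately show ?thesis unfolding bdry_split[OF assms] by (simp add: signed_add)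
qed

lemma bdry_contr_on:
  assumes K: "K \<subseteq> V" "u \<notin> K" "v \<notin> K" and f: "avoids_uv f"
  shows "bdry V (contr f) (insert v K) = bdry V f (insert v K) + signed (even_pos u K = even_pos v K) (bdry V f (insert u K))"
proof -
  have 0: "f (insert u (insert v K)) = 0" "f (insert v (insert u K)) = 0"
    using f unfolding avoids_uv_def by simp_all
  have "signed (even_pos x (insert v K)) (contr f (insert x (insert v K))) =
      signed (even_pos x (insert v K)) (f (insert x (insert v K))) +
      signed (even_pos u K = even_pos v K) (signed (even_pos x (insert u K)) (f (insert x (insert u K))))"
    if x: "x \<in> V - K - {u, v}" for x
  proof -
    have "insert x (insert v K) - {v} = insert x K" using x K by auto
    then have "contr f (insert x (insert v K)) = f (insert x (insert v K))
        + signed (even_pos u (insert x K) = even_pos v (insert x K)) (f (insert u (insert x K)))"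
      unfolding contr_def using x K uv by auto
    moreover have "(even_pos x (insert v K) = (even_pos u (insert x K) = even_pos v (insert x K))) =
        ((even_pos u K = even_pos v K) = even_pos x (insert u K))"
      using x K fin[OF K(1)] by (auto simp: even_pos_insert)
    ultimately show ?thesis by (simp add: signed_add insert_commute)
  qed
  then have "(\<Sum>x\<in>V - K - {u, v}. signed (even_pos x (insert v K)) (contr f (insert x (insert v K)))) =
    (\<Sum>x\<in>V - K - {u, v}. signed (even_pos x (insert v K)) (f (insert x (insert v K)))) +
    signed (even_pos u K = even_pos v K) (\<Sum>x\<in>V - K - {u, v}. signed (even_pos x (insert u K)) (f (insert x (insert u K))))"
    unfolding signed_sum sum.distrib[symmetric] by (intro sum.cong refl) blast
  moreover have "contr f (insert u (insert v K)) = 0" unfolding contr_def by simp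
  ultimately show ?thesis unfolding bdry_split_u[OF K] bdry_split_v[OF K] 0 by simp
qed

lemma bdry_contr_u: "u \<in> G \<Longrightarrow> bdry V (contr f) G = 0"
  unfolding bdry_def contr_def by (intro sum.neutral) auto

lemma is_cycle_contr_iff:
  assumes "avoids_uv f"
  shows "is_cycle V (contr f) \<longleftrightarrow> (\<forall>K\<subseteq>V. u \<notin> K \<longrightarrow> v \<notin> K \<longrightarrow> bdry V f K = 0 \<and>
     bdry V f (insert v K) + signed (even_pos u K = even_pos v K) (bdry V f (insert u K)) = 0)"
proof
  assume c: "is_cycle V (contr f)"
  show "\<forall>K\<subseteq>V. u \<notin> K \<longrightarrow> v \<notin> K \<longrightarrow> bdry V f K = 0 \<and>
     bdry V f (insert v K) + signed (even_pos u K = even_pos v K) (bdry V f (insert u K)) = 0"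
  proof (intro allI impI conjI)
    fix K assume K: "K \<subseteq> V" "u \<notin> K" "v \<notin> K"
    show "bdry V f K = 0" using c K bdry_contr_off[OF K] unfolding is_cycle_def by metis
    have "insert v K \<subseteq> V" using K vV by blast
    then show "bdry V f (insert v K) + signed (even_pos u K = even_pos v K) (bdry V f (insert u K)) = 0"
      using c bdry_contr_on[OF K assms] unfolding is_cycle_def by metis
  qed
next
  assume *: "\<forall>K\<subseteq>V. u \<notin> K \<longrightarrow> v \<notin> K \<longrightarrow> bdry V f K = 0 \<and>
     bdry V f (insert v K) + signed (even_pos u K = even_pos v K) (bdry V f (insert u K)) = 0"
  show "is_cycle V (contr f)"
    unfolding is_cycle_def
  proof (intro allI impI)
    fix G assume G: "G \<subseteq> V"
    consider "u \<in> G" | "u \<notin> G" "v \<notin> G" | "u \<notin> G" "v \<in> G" by blast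
    then show "bdry V (contr f) G = 0"
    proof cases
      case 1
      then show ?thesis by (rule bdry_contr_u)
    next
      case 2
      then show ?thesis using * G bdry_contr_off[OF G] by metis
    next
      case 3
      define K where "K = G - {v}"
      have "K \<subseteq> V" "u \<notin> K" "v \<notin> K" "G = insert v K" using 3 G unfolding K_def by auto
      then show ?thesis using * bdry_contr_on[of K f] assms by metis
    qed
  qed
qed

text \<open>Exactly one of u < v and v < u holds, so exactly one of the two parities
  changes.\<close>

lemma even_pos_uv:
  assumes "K \<subseteq> V" "u \<notin> K" "v \<notin> K"
  shows "(even_pos u (insert v K) = even_pos v (insert u K)) = (even_pos u K \<noteq> even_pos v K)"
  using assms uv fin[OF assms(1)] by (auto simp: even_pos_insert)

lemma bdry_fill_off:
  assumes "G \<subseteq> V" "u \<notin> G" "v \<notin> G"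
  shows "bdry V (fill f) G = bdry V f G"
  unfolding bdry_def fill_def using assms uv by (intro sum.cong) auto

lemma bdry_fill_u:
  assumes K: "K \<subseteq> V" "u \<notin> K" "v \<notin> K" and f: "avoids_uv f"
  shows "bdry V (fill f) (insert u K) = 0"
proof -
  have 0: "f (insert v (insert u K)) = 0" using f unfolding avoids_uv_def by simp
  have "insert v (insert u K) - {v} = insert u K" using K uv by auto
  then have "fill f (insert v (insert u K)) = - signed (even_pos v (insert u K)) (bdry V f (insert u K))"
    unfolding fill_def using K uV vV by simp
  moreover have "(\<Sum>x\<in>V - K - {u, v}. signed (even_pos x (insert u K)) (fill f (insert x (insert u K)))) =
     (\<Sum>x\<in>V - K - {u, v}. signed (even_pos x (insert u K)) (f (insert x (insert u K))))"
    using K uv by (intro sum.cong) (auto simp: fill_def)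
  moreover have "bdry V f (insert u K) =
      (\<Sum>x\<in>V - K - {u, v}. signed (even_pos x (insert u K)) (f (insert x (insert u K))))"
    unfolding bdry_split_u[OF K] 0 by simp
  ultimately show ?thesis
    unfolding bdry_split_u[OF K, of "fill f"] by simp (simp add: signed_def)
qed

lemma bdry_fill_v:
  assumes K: "K \<subseteq> V" "u \<notin> K" "v \<notin> K" and f: "avoids_uv f"
  shows "bdry V (fill f) (insert v K) =
    bdry V f (insert v K) + signed (even_pos u K = even_pos v K) (bdry V f (insert u K))"
proof -
  have 0: "f (insert u (insert v K)) = 0" using f unfolding avoids_uv_def by simp
  have "insert u (insert v K) - {v} = insert u K" using K uv by auto
  then have "fill f (insert u (insert v K)) = - signed (even_pos v (insert u K)) (bdry V f (insert u K))"
    unfolding fill_def using K uV vV by simp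
  moreover have "(\<Sum>x\<in>V - K - {u, v}. signed (even_pos x (insert v K)) (fill f (insert x (insert v K)))) =
     (\<Sum>x\<in>V - K - {u, v}. signed (even_pos x (insert v K)) (f (insert x (insert v K))))"
    using K uv by (intro sum.cong) (auto simp: fill_def)
  moreover have "bdry V f (insert v K) =
      (\<Sum>x\<in>V - K - {u, v}. signed (even_pos x (insert v K)) (f (insert x (insert v K))))"
    unfolding bdry_split_v[OF K] 0 by simp
  moreover have "- signed (even_pos u (insert v K) = even_pos v (insert u K)) b = signed (even_pos u K = even_pos v K) b" for b :: 'a
    unfolding even_pos_uv[OF K] signed_def by auto
  ultimately show ?thesis
    unfolding bdry_split_v[OF K, of "fill f"] by simp
qed

text \<open>The case of a face \<open>G\<close> containing both \<open>u\<close> and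
  \<open>v\<close> follows from \<open>bdry_bdry\<close> at \<open>G - {v}\<close>: the boundary of
  the filling is already known to vanish on the other faces occurring there, so the term of
  \<open>G\<close> must vanish too.\<close>

lemma is_cycle_fill:
  assumes f: "avoids_uv f" and c: "is_cycle V (contr f)"
  shows "is_cycle V (fill f)"
  unfolding is_cycle_def
proof (intro allI impI)
  note c' = c[unfolded is_cycle_contr_iff[OF f], rule_format]
  fix G assume G: "G \<subseteq> V"
  consider "u \<notin> G" "v \<notin> G" | "u \<notin> G" "v \<in> G" | "u \<in> G" "v \<notin> G" | "u \<in> G" "v \<in> G" by blast
  then show "bdry V (fill f) G = 0"
  proof cases
    case 1
    then show ?thesis using c' G bdry_fill_off by metis
  next
    case 2
    define K where "K = G - {v}"
    have K: "K \<subseteq> V" "u \<notin> K" "v \<notin> K" "G = insert v K" using 2 G unfolding K_def by auto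
    then show ?thesis using c'[OF K(1-3)] bdry_fill_v[OF K(1-3) f] by simp
  next
    case 3
    define K where "K = G - {u}"
    have K: "K \<subseteq> V" "u \<notin> K" "v \<notin> K" "G = insert u K" using 3 G unfolding K_def by auto
    then show ?thesis using bdry_fill_u[OF K(1-3) f] by simp
  next
    case 4
    define L where "L = G - {u, v}"
    have L: "L \<subseteq> V" "u \<notin> L" "v \<notin> L" "G = insert v (insert u L)" using 4 G unfolding L_def by auto
    have uL: "insert u L \<subseteq> V" using L uV by auto
    have "bdry V (fill f) (insert x (insert u L)) = 0" if "x \<in> V - insert u L" "x \<noteq> v" for x
      using bdry_fill_u[of "insert x L" f] that L f by (auto simp: insert_commute)
    then have "(\<Sum>x\<in>V - insert u L. signed (even_pos x (insert u L)) (bdry V (fill f) (insert x (insert u L)))) =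
      (\<Sum>x\<in>V - insert u L. if x = v then signed (even_pos v (insert u L)) (bdry V (fill f) G) else 0)"
      using L(4) by (intro sum.cong) auto
    also have "\<dots> = signed (even_pos v (insert u L)) (bdry V (fill f) G)"
      using V vV uv L by simp
    finally show ?thesis using bdry_bdry[OF V uL, of "fill f"] by simp
  qed
qed

text \<open>The cycle condition of \<open>c\<close> at \<open>insert u K\<close> expresses its
  coefficient at \<open>insert v (insert u K)\<close> by coefficients of faces without
  \<open>v\<close>. This is the formula in \<open>fill\<close>, so discarding the faces through the
  edge loses no information.\<close>

lemma fill_off_cycle:
  assumes c: "is_cycle V c" "supp c \<subseteq> Pow V"
  defines "f \<equiv> restrict c {F. \<not> (u \<in> F \<and> v \<in> F)}"
  shows "is_cycle V (contr f)" "fill f = c"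
proof -
  have f: "avoids_uv f" unfolding avoids_uv_def f_def restrict_def by simp
  have u: "bdry V f (insert u K) = - signed (even_pos v (insert u K)) (c (insert v (insert u K)))"
    and v: "bdry V f (insert v K) = - signed (even_pos u (insert v K)) (c (insert v (insert u K)))"
    if K: "K \<subseteq> V" "u \<notin> K" "v \<notin> K" for K
  proof -
    have "bdry V c (insert u K) = 0" "bdry V c (insert v K) = 0"
      using c K uV vV unfolding is_cycle_def by auto
    note c0 = this[unfolded bdry_split_u[OF K] bdry_split_v[OF K] add_eq_0_iff]
    have sums: "(\<Sum>x\<in>V - K - {u, v}. signed (even_pos x (insert u K)) (f (insert x (insert u K)))) =
     (\<Sum>x\<in>V - K - {u, v}. signed (even_pos x (insert u K)) (c (insert x (insert u K))))"
     "(\<Sum>x\<in>V - K - {u, v}. signed (even_pos x (insert v K)) (f (insert x (insert v K)))) =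
     (\<Sum>x\<in>V - K - {u, v}. signed (even_pos x (insert v K)) (c (insert x (insert v K))))"
      using K uv by (intro sum.cong; auto simp: f_def restrict_def)+
    have f0: "f (insert u (insert v K)) = 0" "f (insert v (insert u K)) = 0"
      using f unfolding avoids_uv_def by simp_all
    show "bdry V f (insert u K) = - signed (even_pos v (insert u K)) (c (insert v (insert u K)))"
      unfolding bdry_split_u[OF K] sums f0 c0(1) by simp
    show "bdry V f (insert v K) = - signed (even_pos u (insert v K)) (c (insert v (insert u K)))"
      unfolding bdry_split_v[OF K] sums f0 c0(2) by (simp add: insert_commute)
  qed
  show "is_cycle V (contr f)"
    unfolding is_cycle_contr_iff[OF f]
  proof (intro allI impI conjI)
    fix K assume K: "K \<subseteq> V" "u \<notin> K" "v \<notin> K"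
    have "bdry V f K = bdry V c K"
      unfolding bdry_def using K uv by (intro sum.cong) (auto simp: f_def restrict_def)
    then show "bdry V f K = 0" using c K unfolding is_cycle_def by simp
    have "(even_pos u K = even_pos v K) = even_pos v (insert u K) \<longleftrightarrow> \<not> even_pos u (insert v K)"
      using even_pos_uv[OF K] by blast
    then show "bdry V f (insert v K) + signed (even_pos u K = even_pos v K) (bdry V f (insert u K)) = 0"
      unfolding u[OF K] v[OF K] by simp
  qed
  show "fill f = c"
  proof
    fix F
    show "fill f F = c F"
    proof (cases "u \<in> F \<and> v \<in> F \<and> F \<subseteq> V")
      case True
      define K where "K = F - {u, v}"
      have K: "K \<subseteq> V" "u \<notin> K" "v \<notin> K" "F = insert v (insert u K)" "F - {v} = insert u K"
        using True uv unfolding K_def by auto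
      then show ?thesis using True u[OF K(1-3)] unfolding fill_def by (simp add: signed_def)
    next
      case False
      then show ?thesis using c(2) unfolding fill_def f_def restrict_def supp_def by auto
    qed
  qed
qed

lemma avoids_uv_restrict: "(\<And>F. F \<in> A \<Longrightarrow> \<not> (u \<in> F \<and> v \<in> F)) \<Longrightarrow> avoids_uv (restrict c A)"
  unfolding avoids_uv_def restrict_def by auto

end

lemma restrict_add:
  fixes c :: "'v set \<Rightarrow> 'g::ab_group_add"
  assumes "A \<inter> B = {}"
  shows "restrict c (A \<union> B) = (\<lambda>F. restrict c A F + restrict c B F)"
  using assms unfolding restrict_def by (intro ext) auto

section \<open>Decomposition of a minimal cycle into pieces\<close>

locale contracted_cycle = contraction V u v
  for V :: "'v::linorder set" and u v :: 'v +
  fixes c :: "'v set \<Rightarrow> 'g::ab_group_add" and F0 :: "'v set"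
  assumes c: "is_min_cycle V c" and F0: "F0 \<in> supp c" "u \<in> F0" "v \<in> F0"
begin

definition \<S> :: "'v set set" where
  "\<S> = {F \<in> supp c. \<not> (u \<in> F \<and> v \<in> F)}"

definition contr_cycle :: "'v set set \<Rightarrow> bool" where
  "contr_cycle A \<longleftrightarrow> is_cycle V (contr (restrict c A))"

text \<open>Up to sign, the coefficient at \<open>insert u (insert v K)\<close> of the filling of
  \<open>A\<close>; see \<open>fill_restrict_uv\<close>.\<close>

definition \<beta> :: "'v set set \<Rightarrow> 'v set \<Rightarrow> 'g" where
  "\<beta> A K = bdry V (restrict c A) (insert u K)"

definition piece :: "'v set set \<Rightarrow> bool" where
  "piece B \<longleftrightarrow> B \<subseteq> \<S> \<and> B \<noteq> {} \<and> contr_cycle B \<and> (\<forall>A\<subseteq>B. contr_cycle A \<longrightarrow> A = {} \<or> A = B)"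

lemma supp_sub: "supp c \<subseteq> Pow V" and \<S>_sub: "\<S> \<subseteq> supp c" and finite_\<S>: "finite \<S>"
proof -
  show *: "supp c \<subseteq> Pow V" using c unfolding is_min_cycle_def by blast
  show **: "\<S> \<subseteq> supp c" unfolding \<S>_def by blast
  show "finite \<S>" using finite_subset[OF subset_trans[OF ** *]] V by simp
qed

lemma avoids_uv_sub: "A \<subseteq> \<S> \<Longrightarrow> avoids_uv (restrict c A)"
  by (rule avoids_uv_restrict) (auto simp: \<S>_def)

lemma contr_cycle_union_iff:
  assumes "contr_cycle A" "A \<inter> B = {}"
  shows "contr_cycle (A \<union> B) \<longleftrightarrow> contr_cycle B"
proof -
  have "contr (restrict c (A \<union> B)) = (\<lambda>G. contr (restrict c A) G + contr (restrict c B) G)"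
    unfolding restrict_add[OF assms(2)] by (rule ext) (rule contr_add)
  then show ?thesis using assms(1) unfolding contr_cycle_def is_cycle_def by (auto simp: bdry_add)
qed

lemma \<beta>_union: "A \<inter> B = {} \<Longrightarrow> \<beta> (A \<union> B) K = \<beta> A K + \<beta> B K"
  unfolding \<beta>_def by (simp add: restrict_add bdry_add)

lemma contr_cycle_diff:
  assumes "contr_cycle A" "contr_cycle B" "B \<subseteq> A"
  shows "contr_cycle (A - B)"
  using contr_cycle_union_iff[OF assms(2), of "A - B"] assms by (auto simp: Un_absorb1)

lemma restrict_\<S>: "restrict c \<S> = restrict c {F. \<not> (u \<in> F \<and> v \<in> F)}"
  unfolding restrict_def \<S>_def supp_def by auto

lemma contr_cycle_\<S>: "contr_cycle \<S>" and fill_\<S>: "fill (restrict c \<S>) = c"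
  using fill_off_cycle[of c] c unfolding contr_cycle_def restrict_\<S> is_min_cycle_def by auto

lemma \<beta>_empty [simp]: "\<beta> {} K = 0"
  unfolding \<beta>_def bdry_def restrict_def by simp

text \<open>A set that is not a piece splits into two smaller sets whose contractions are cycles. As
  \<open>\<beta>\<close> is additive, one of them keeps a nonzero value at \<open>K\<close>.\<close>

lemma piece_exists:
  assumes "A \<subseteq> \<S>" "contr_cycle A" "\<beta> A K \<noteq> 0"
  shows "\<exists>B\<subseteq>A. piece B \<and> \<beta> B K \<noteq> 0"
proof -
  have "finite A" using assms(1) finite_\<S> finite_subset by blast
  then show ?thesis using assms
  proof (induction A rule: finite_psubset_induct)
    case (psubset A)
    show ?case
    proof (cases "piece A")
      case True
      then show ?thesis using psubset.prems by blast
    next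
      case False
      moreover have "A \<noteq> {}" using psubset.prems by auto
      ultimately obtain A' where A': "A' \<subseteq> A" "contr_cycle A'" "A' \<noteq> {}" "A' \<noteq> A"
        using psubset.prems unfolding piece_def by blast
      have contr_cycle: "contr_cycle (A - A')" using contr_cycle_diff A' psubset.prems by blast
      have "\<beta> A K = \<beta> A' K + \<beta> (A - A') K"
        using \<beta>_union[of A' "A - A'" K] A'(1) by (simp add: Un_absorb1)
      then consider "\<beta> A' K \<noteq> 0" | "\<beta> (A - A') K \<noteq> 0" using psubset.prems by force
      then show ?thesis
      proof cases
        case 1
        then have "\<exists>B\<subseteq>A'. piece B \<and> \<beta> B K \<noteq> 0"
          using A' psubset.prems by (intro psubset.IH) auto
        then show ?thesis using A' by blast
      next
        case 2
        then have "\<exists>B\<subseteq>A - A'. piece B \<and> \<beta> B K \<noteq> 0"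
          using A' contr_cycle psubset.prems by (intro psubset.IH) auto
        then show ?thesis by blast
      qed
    qed
  qed
qed

lemma fill_restrict_uv:
  assumes "K \<subseteq> V" "u \<notin> K" "v \<notin> K"
  shows "fill (restrict c A) (insert u (insert v K)) = - signed (even_pos v (insert u K)) (\<beta> A K)"
proof -
  have "insert u (insert v K) - {v} = insert u K" using assms uv by auto
  then show ?thesis unfolding fill_def \<beta>_def using assms uV vV by simp
qed

text \<open>A nonzero boundary at \<open>insert u K\<close> needs a face of \<open>A\<close> above
  it, and the cycle condition of the contraction transfers the nonzero value to
  \<open>insert v K\<close>. The purpose is that \<open>K\<close> consists of common neighbours of
  \<open>u\<close> and \<open>v\<close>.\<close>

lemma \<beta>_faces:
  assumes A: "A \<subseteq> \<S>" "contr_cycle A" and K: "K \<subseteq> V" "u \<notin> K" "v \<notin> K" and nz: "\<beta> A K \<noteq> 0"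
  shows "\<exists>y. y \<notin> insert u K \<and> insert y (insert u K) \<in> A"
    and "\<exists>y. y \<notin> insert v K \<and> insert y (insert v K) \<in> A"
proof -
  have *: "\<exists>y. y \<notin> G \<and> insert y G \<in> A" if "bdry V (restrict c A) G \<noteq> 0" for G
  proof (rule ccontr)
    assume "\<not> ?thesis"
    then have "bdry V (restrict c A) G = 0" unfolding bdry_def restrict_def by (intro sum.neutral) auto
    with that show False by simp
  qed
  show "\<exists>y. y \<notin> insert u K \<and> insert y (insert u K) \<in> A"
    using * nz unfolding \<beta>_def by blast
  have "bdry V (restrict c A) (insert v K) + signed (even_pos u K = even_pos v K) (\<beta> A K) = 0"
    using A(2) K unfolding contr_cycle_def is_cycle_contr_iff[OF avoids_uv_sub[OF A(1)]] \<beta>_def by blast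
  then have "bdry V (restrict c A) (insert v K) \<noteq> 0" using nz by auto
  then show "\<exists>y. y \<notin> insert v K \<and> insert y (insert v K) \<in> A" using * by blast
qed

text \<open>The filling is a cycle and nonzero at \<open>insert u (insert v K)\<close>, so the ridge
  obtained by deleting \<open>w\<close> lies in a second face of its support. The new vertex
  \<open>w'\<close> becomes the additional common neighbour.\<close>

lemma \<beta>_exchange:
  assumes A: "A \<subseteq> \<S>" "contr_cycle A" and K: "K \<subseteq> V" "u \<notin> K" "v \<notin> K" and nz: "\<beta> A K \<noteq> 0"
    and w: "w \<in> K"
  shows "\<exists>w'\<in>V. w' \<notin> K \<and> w' \<noteq> u \<and> w' \<noteq> v \<and> \<beta> A (insert w' (K - {w})) \<noteq> 0"
proof (rule ccontr)
  assume *: "\<not> ?thesis"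
  let ?f = "fill (restrict c A)" and ?L = "K - {w}"
  let ?G = "insert u (insert v ?L)"
  have G: "?G \<subseteq> V" using K uV vV by auto
  have 0: "?f (insert x ?G) = 0" if "x \<in> V - ?G" "x \<noteq> w" for x
  proof -
    have "insert x ?G = insert u (insert v (insert x ?L))" by auto
    moreover have "\<beta> A (insert x ?L) = 0" using * that by blast
    ultimately show ?thesis
      using fill_restrict_uv[of "insert x ?L" A] that K by auto
  qed
  have "insert w ?G = insert u (insert v K)" using w by auto
  then have w0: "?f (insert w ?G) \<noteq> 0" using fill_restrict_uv[OF K] nz by simp
  have "bdry V ?f ?G = (\<Sum>x\<in>V - ?G. if x = w then signed (even_pos w ?G) (?f (insert w ?G)) else 0)"
    unfolding bdry_def using 0 by (intro sum.cong) auto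
  also have "\<dots> = signed (even_pos w ?G) (?f (insert w ?G))"
    using V w K by auto
  finally have "bdry V ?f ?G \<noteq> 0" using w0 by simp
  then show False
    using is_cycle_fill[OF avoids_uv_sub[OF A(1)]] A(2) G unfolding contr_cycle_def is_cycle_def by blast
qed

text \<open>Since \<open>c\<close> is the filling of \<S>, agreement of \<open>\<beta> A\<close>
  with \<open>\<beta> \<S>\<close> wherever the former is nonzero makes each coefficient of the
  filling of \<open>A\<close> either 0 or that of \<open>c\<close>.\<close>

lemma fill_eq_restrict:
  assumes A: "A \<subseteq> \<S>" and cl: "\<And>K. K \<subseteq> V \<Longrightarrow> u \<notin> K \<Longrightarrow> v \<notin> K \<Longrightarrow> \<beta> A K \<noteq> 0 \<Longrightarrow> \<beta> A K = \<beta> \<S> K"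
  obtains A' where "A' \<subseteq> supp c" "A' \<inter> \<S> = A" "fill (restrict c A) = restrict c A'"
    "\<And>F. F \<in> A' \<Longrightarrow> u \<in> F \<Longrightarrow> v \<in> F \<Longrightarrow> F \<subseteq> V \<and> \<beta> A (F - {u, v}) \<noteq> 0"
proof
  define A' where "A' = A \<union> {F. u \<in> F \<and> v \<in> F \<and> F \<subseteq> V \<and> \<beta> A (F - {u, v}) \<noteq> 0}"
  have uvF: "fill (restrict c B) F = - signed (even_pos v (insert u (F - {u, v}))) (\<beta> B (F - {u, v}))"
    if "u \<in> F" "v \<in> F" "F \<subseteq> V" for B F
  proof -
    have "insert u (insert v (F - {u, v})) = F" using that by auto
    moreover have "F - {u, v} \<subseteq> V" using that by auto
    ultimately show ?thesis using fill_restrict_uv[of "F - {u, v}" B] by simp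
  qed
  have c': "fill (restrict c A) F = c F" "c F \<noteq> 0"
    if "u \<in> F" "v \<in> F" "F \<subseteq> V" "\<beta> A (F - {u, v}) \<noteq> 0" for F
  proof -
    have "\<beta> A (F - {u, v}) = \<beta> \<S> (F - {u, v})" using that by (intro cl) auto
    then have "fill (restrict c A) F = fill (restrict c \<S>) F" using uvF that by simp
    then show *: "fill (restrict c A) F = c F" unfolding fill_\<S> .
    show "c F \<noteq> 0" using uvF[OF that(1-3), of A] that(4) unfolding * by simp
  qed
  show "A' \<subseteq> supp c" using A \<S>_sub c' unfolding A'_def supp_def by auto
  show "A' \<inter> \<S> = A" using A unfolding A'_def \<S>_def by auto
  show "fill (restrict c A) = restrict c A'"
  proof
    fix F
    show "fill (restrict c A) F = restrict c A' F"
    proof (cases "u \<in> F \<and> v \<in> F \<and> F \<subseteq> V")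
      case True
      moreover have "F \<notin> A" using True A unfolding \<S>_def by auto
      ultimately show ?thesis using c'[of F] uvF[of F A]
        by (cases "\<beta> A (F - {u, v}) = 0") (auto simp: restrict_def A'_def)
    next
      case False
      then have "fill (restrict c A) F = restrict c A F" unfolding fill_def by auto
      then show ?thesis using False unfolding restrict_def A'_def by auto
    qed
  qed
  show "F \<subseteq> V \<and> \<beta> A (F - {u, v}) \<noteq> 0" if "F \<in> A'" "u \<in> F" "v \<in> F" for F
    using that A unfolding A'_def \<S>_def by auto
qed

text \<open>Under the hypothesis the filling of \<open>A\<close> is a cycle and a subchain of the minimal cycle
  \<open>c\<close>.\<close>

lemma closed_subset_eq:
  assumes A: "A \<subseteq> \<S>" "contr_cycle A" "A \<noteq> {}"
    and cl: "\<And>K. K \<subseteq> V \<Longrightarrow> u \<notin> K \<Longrightarrow> v \<notin> K \<Longrightarrow> \<beta> A K \<noteq> 0 \<Longrightarrow> \<beta> (\<S> - A) K = 0"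
  obtains "A = \<S>" "\<exists>K\<subseteq>V. u \<notin> K \<and> v \<notin> K \<and> \<beta> A K \<noteq> 0"
    "\<And>F. F \<in> supp c \<Longrightarrow> u \<in> F \<Longrightarrow> v \<in> F \<Longrightarrow> \<beta> A (F - {u, v}) \<noteq> 0"
proof -
  have "\<beta> A K = \<beta> \<S> K" if "K \<subseteq> V" "u \<notin> K" "v \<notin> K" "\<beta> A K \<noteq> 0" for K
    using cl[OF that] \<beta>_union[of A "\<S> - A" K] A(1) by (simp add: Un_absorb1)
  from fill_eq_restrict[OF A(1) this] obtain A' where A': "A' \<subseteq> supp c" "A' \<inter> \<S> = A"
    "fill (restrict c A) = restrict c A'"
    "\<And>F. F \<in> A' \<Longrightarrow> u \<in> F \<Longrightarrow> v \<in> F \<Longrightarrow> F \<subseteq> V \<and> \<beta> A (F - {u, v}) \<noteq> 0"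
    by blast
  have "is_cycle V (restrict c A')"
    using is_cycle_fill[OF avoids_uv_sub[OF A(1)]] A(2) unfolding A'(3) contr_cycle_def by blast
  then have eq: "A' = supp c" using c A' A(3) unfolding is_min_cycle_def by blast
  show thesis
  proof
    show "A = \<S>" using A'(2) \<S>_sub eq by auto
    show *: "\<beta> A (F - {u, v}) \<noteq> 0" if "F \<in> supp c" "u \<in> F" "v \<in> F" for F
      using A'(4) that unfolding eq by blast
    have "F0 - {u, v} \<subseteq> V" using F0 supp_sub by auto
    then show "\<exists>K\<subseteq>V. u \<notin> K \<and> v \<notin> K \<and> \<beta> A K \<noteq> 0" using *[OF F0] by blast
  qed
qed

text \<open>If \<open>\<beta> B\<close> were identically 0, the hypothesis of
  \<open>closed_subset_eq\<close> would hold vacuously, while its conclusion supplies a nonzero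
  value.\<close>

lemma piece_\<beta>:
  assumes "piece B"
  shows "\<exists>K\<subseteq>V. u \<notin> K \<and> v \<notin> K \<and> \<beta> B K \<noteq> 0"
proof (rule ccontr)
  assume *: "\<not> ?thesis"
  have B: "B \<subseteq> \<S>" "contr_cycle B" "B \<noteq> {}" using assms unfolding piece_def by auto
  show False
    by (rule closed_subset_eq[OF B]) (use * in blast)+
qed

lemma \<S>_nonempty: "\<S> \<noteq> {}"
proof
  assume "\<S> = {}"
  have "c = fill (restrict c {})" using fill_\<S> \<open>\<S> = {}\<close> by simp
  also have "\<dots> = (\<lambda>_. 0)" by (rule ext) (simp add: fill_def restrict_def bdry_def)
  finally show False using F0(1) unfolding supp_def by simp
qed

lemma \<S>_\<beta>:
  "\<exists>K\<subseteq>V. u \<notin> K \<and> v \<notin> K \<and> \<beta> \<S> K \<noteq> 0"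
  "F \<in> supp c \<Longrightarrow> u \<in> F \<Longrightarrow> v \<in> F \<Longrightarrow> \<beta> \<S> (F - {u, v}) \<noteq> 0"
proof -
  have 0: "\<beta> (\<S> - \<S>) K = 0" for K by simp
  show "\<exists>K\<subseteq>V. u \<notin> K \<and> v \<notin> K \<and> \<beta> \<S> K \<noteq> 0"
    by (rule closed_subset_eq[OF order_refl contr_cycle_\<S> \<S>_nonempty 0])
  show "F \<in> supp c \<Longrightarrow> u \<in> F \<Longrightarrow> v \<in> F \<Longrightarrow> \<beta> \<S> (F - {u, v}) \<noteq> 0"
    by (rule closed_subset_eq[OF order_refl contr_cycle_\<S> \<S>_nonempty 0])
qed

text \<open>A coefficient can cancel only between \<open>insert u K\<close> and
  \<open>insert v K\<close>. If it does, these two faces already have contraction 0 and are the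
  whole piece by minimality, which leaves one image. Without cancellation the support of the
  contraction is the full image.\<close>

lemma piece_contraction:
  assumes B: "piece B"
  obtains (simplex) G where "\<pi> ` B = {G}"
  | (cycle) "is_min_cycle V (contr (restrict c B))" "supp (contr (restrict c B)) = \<pi> ` B"
proof -
  let ?f = "restrict c B"
  have BS: "B \<subseteq> \<S>" and QB: "contr_cycle B" and min: "\<And>A. A \<subseteq> B \<Longrightarrow> contr_cycle A \<Longrightarrow> A = {} \<or> A = B"
    using B unfolding piece_def by auto
  have cB: "c F \<noteq> 0" "\<not> (u \<in> F \<and> v \<in> F)" if "F \<in> B" for F
    using that BS unfolding \<S>_def supp_def by auto
  show thesis
  proof (cases "\<exists>K. u \<notin> K \<and> v \<notin> K \<and> insert u K \<in> B \<and> insert v K \<in> B \<and> contr ?f (insert v K) = 0")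
    case True
    then obtain K where K: "u \<notin> K" "v \<notin> K" "insert u K \<in> B" "insert v K \<in> B"
      "contr ?f (insert v K) = 0" by blast
    let ?A = "{insert u K, insert v K}"
    have "contr (restrict c ?A) G = 0" for G
    proof (cases "G = insert v K")
      case True
      have "insert v K - {v} = K" using K by auto
      then have "contr (restrict c ?A) G = contr ?f (insert v K)"
        unfolding True contr_def restrict_def using K by auto
      then show ?thesis using K(5) by simp
    next
      case False
      have "insert u (G - {v}) = insert u K \<Longrightarrow> v \<in> G \<Longrightarrow> u \<notin> G \<Longrightarrow> G = insert v K"
        using K by (metis Diff_insert_absorb Diff_iff insert_Diff)
      moreover have "insert u (G - {v}) \<noteq> insert v K" using K uv by auto
      ultimately show ?thesis
        using False unfolding contr_def restrict_def by auto
    qed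
    then have "contr_cycle ?A" unfolding contr_cycle_def is_cycle_def bdry_def by simp
    then have "B = ?A" using min[of ?A] K by auto
    moreover have "insert v (insert u K - {u}) = insert v K" using K by auto
    ultimately have "\<pi> ` B = {insert v K}" unfolding \<pi>_def using K uv by auto
    then show thesis by (rule simplex)
  next
    case noK: False
    have supp: "supp (contr ?f) = \<pi> ` B"
    proof (intro equalityI subsetI)
      fix G assume "G \<in> supp (contr ?f)"
      then have G: "contr ?f G \<noteq> 0" unfolding supp_def by simp
      then have uG: "u \<notin> G" unfolding contr_def by auto
      show "G \<in> \<pi> ` B"
      proof (cases "G \<in> B")
        case True
        then show ?thesis using uG unfolding \<pi>_def by (auto intro!: image_eqI[of _ _ G])
      next
        case False
        then have "v \<in> G" "insert u (G - {v}) \<in> B"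
          using G uG unfolding contr_def restrict_def by (auto split: if_splits)
        moreover have "\<pi> (insert u (G - {v})) = G" using \<open>v \<in> G\<close> uG unfolding \<pi>_def by auto
        ultimately show ?thesis by (metis imageI)
      qed
    next
      fix G assume "G \<in> \<pi> ` B"
      then obtain F where F: "F \<in> B" "G = \<pi> F" by blast
      have "contr ?f G \<noteq> 0"
      proof (cases "u \<in> F \<or> v \<in> F")
        case False
        then show ?thesis using F cB unfolding contr_def \<pi>_def restrict_def by auto
      next
        case True
        define K where "K = F - {u, v}"
        have K: "u \<notin> K" "v \<notin> K" "G = insert v K" "F = insert u K \<or> F = insert v K"
          using True cB(2)[OF F(1)] F(2) uv unfolding K_def \<pi>_def by auto
        have Kv: "insert v K - {v} = K" using K by auto
        show ?thesis
        proof (cases "insert u K \<in> B \<and> insert v K \<in> B")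
          case True
          then show ?thesis using noK K(1-3) by blast
        next
          case False
          then show ?thesis
            using K F(1) uv cB(1)[OF F(1)] unfolding K(3) contr_def restrict_def Kv by auto
        qed
      qed
      then show "G \<in> supp (contr ?f)" unfolding supp_def by simp
    qed
    have "is_min_cycle V (contr ?f)"
      unfolding is_min_cycle_def
    proof (intro conjI allI impI)
      show "supp (contr ?f) \<subseteq> Pow V"
      proof
        fix G assume "G \<in> supp (contr ?f)"
        then obtain F where "F \<in> B" "G = \<pi> F" unfolding supp by blast
        then show "G \<in> Pow V" using BS \<S>_sub supp_sub vV unfolding \<pi>_def by auto
      qed
      show "is_cycle V (contr ?f)" using QB unfolding contr_cycle_def .
      fix T assume T: "T \<subseteq> supp (contr ?f)" "is_cycle V (restrict (contr ?f) T)"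
      \<comment> \<open>A subchain of the contraction lifts to the set of all faces that
        \<open>\<pi>\<close> maps into it, so minimality passes from the piece to its
        contraction.\<close>
      let ?A = "{F \<in> B. \<pi> F \<in> T}"
      have "contr (restrict c ?A) = restrict (contr ?f) T"
      proof
        fix G
        have "\<pi> (insert u (G - {v})) = G" if "v \<in> G" "u \<notin> G"
          using that unfolding \<pi>_def by auto
        moreover have "\<pi> G = G" if "u \<notin> G" using that unfolding \<pi>_def by simp
        ultimately show "contr (restrict c ?A) G = restrict (contr ?f) T G"
          unfolding contr_def restrict_def by auto
      qed
      then have "contr_cycle ?A" using T(2) unfolding contr_cycle_def by simp
      then consider "?A = {}" | "?A = B" using min[of ?A] by blast
      then show "T = {} \<or> T = supp (contr ?f)" using T(1) unfolding supp by cases blast+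
    qed
    then show thesis using supp by (rule cycle)
  qed
qed

end

section \<open>Rigidity of minimal cycles\<close>

text \<open>\<open>no_single\<close> is the form taken by the bound 2 on the block sizes: a color
  that labels no block has 0 coordinates, every other color has at least 2.\<close>

locale colored_order = colored_space d col \<kappa>
  for d :: nat and col :: "nat \<Rightarrow> nat" and \<kappa> :: "'v::linorder \<Rightarrow> nat" +
  assumes d3: "3 \<le> d" and no_single: "card {k. k < d \<and> col k = i} \<noteq> 1"
begin

definition color_count :: "'v set \<Rightarrow> nat \<Rightarrow> nat" where
  "color_count A i = card {f \<in> A. \<kappa> f = i}"

text \<open>The color pattern of a facet of the balanced complex. It survives the replacement of a
  vertex by one of the same color, hence also contraction.\<close>

definition saturated :: "'v set \<Rightarrow> bool" where
  "saturated F \<longleftrightarrow> finite F \<and> (\<forall>i. color_count F i = card {k. k < d \<and> col k = i})"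

definition edge_pairs :: "'v set set \<Rightarrow> ('v \<times> 'v) set" where
  "edge_pairs \<F> = {(a, b). \<exists>F\<in>\<F>. a \<in> F \<and> b \<in> F}"

lemma color_count_insert:
  assumes "finite A" "x \<notin> A"
  shows "color_count (insert x A) i = color_count A i + (if \<kappa> x = i then 1 else 0)"
proof -
  have "{f \<in> insert x A. \<kappa> f = i} = (if \<kappa> x = i then insert x {f \<in> A. \<kappa> f = i} else {f \<in> A. \<kappa> f = i})"
    by auto
  then show ?thesis unfolding color_count_def using assms by simp
qed

lemma saturated_card:
  assumes "saturated F"
  shows "card F = d"
proof -
  have F: "finite F" "\<And>i. card {f \<in> F. \<kappa> f = i} = card {k \<in> {..<d}. col k = i}"
    using assms unfolding saturated_def color_count_def by auto
  define I where "I = \<kappa> ` F \<union> col ` {..<d}"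
  have I: "finite I" "\<kappa> ` F \<subseteq> I" "col ` {..<d} \<subseteq> I" using F unfolding I_def by auto
  have "card F = (\<Sum>i\<in>I. card {f \<in> F. \<kappa> f = i})"
    using sum.group[OF F(1) I(1,2), of "\<lambda>_. 1::nat"] by simp
  also have "\<dots> = card {..<d}"
    using sum.group[OF finite_lessThan I(1,3), of "\<lambda>_. 1::nat"] F(2) by simp
  finally show ?thesis by simp
qed

lemma saturated_fits:
  assumes "saturated F" "A \<subseteq> F"
  shows "\<exists>\<phi>. fits \<phi> A"
proof (rule fits_exists)
  show "finite A" using assms finite_subset unfolding saturated_def by blast
  fix i
  have "card {v \<in> A. \<kappa> v = i} \<le> color_count F i"
    unfolding color_count_def using assms by (intro card_mono) (auto simp: saturated_def)
  then show "card {v \<in> A. \<kappa> v = i} \<le> card {k. k < d \<and> col k = i}"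
    using assms unfolding saturated_def by simp
qed

lemma saturated_same_color:
  assumes "saturated F" "f \<in> F"
  shows "\<exists>g\<in>F. g \<noteq> f \<and> \<kappa> g = \<kappa> f"
proof (rule ccontr)
  assume "\<not> ?thesis"
  then have "{g \<in> F. \<kappa> g = \<kappa> f} = {f}" using assms(2) by auto
  then have "color_count F (\<kappa> f) = 1" unfolding color_count_def by simp
  then show False using assms(1) no_single unfolding saturated_def by metis
qed

lemma generic_spanning_saturated:
  assumes "saturated F"
  shows "generic (\<lambda>x. spanning F (sparsify x))"
proof -
  obtain \<phi> where "fits \<phi> F" using saturated_fits[OF assms order_refl] by blast
  moreover have "finite F" using assms unfolding saturated_def by blast
  ultimately show ?thesis using generic_spanning saturated_card[OF assms] by blast
qed

lemma generic_nondeg_saturated: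
  assumes "saturated G" "finite F" "card F = d" "f0 \<in> F" "F - {f0} \<subseteq> G"
  shows "generic (\<lambda>x. nondeg F (sparsify x))"
  using saturated_fits[OF assms(1,5)] by (elim exE) (rule generic_nondeg[OF assms(2-4)])

lemma saturated_insert_iff:
  assumes "finite A" "x \<notin> A" "y \<notin> A" "\<kappa> x = \<kappa> y"
  shows "saturated (insert x A) \<longleftrightarrow> saturated (insert y A)"
  unfolding saturated_def using assms by (simp add: color_count_insert)

lemma generic_rigid_saturated:
  assumes "saturated G"
  shows "generic (\<lambda>x. rigid G (edge_pairs {G}) (sparsify x))"
proof -
  obtain \<phi> where "fits \<phi> G" using saturated_fits[OF assms order_refl] by blast
  moreover have "finite G" using assms unfolding saturated_def by blast
  moreover have "G \<times> G \<subseteq> edge_pairs {G}" unfolding edge_pairs_def by auto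
  ultimately show ?thesis using generic_rigid_simplex saturated_card[OF assms] by blast
qed

end

text \<open>The induction hypothesis is an assumption of the locale. It covers minimal cycles on the
  vertices of \<open>c\<close> other than \<open>u\<close>, which is where contractions of pieces
  live.\<close>

locale colored_cycle = colored_order d col \<kappa> + contracted_cycle V u v c F0
  for d :: nat and col :: "nat \<Rightarrow> nat" and \<kappa> :: "'v::linorder \<Rightarrow> nat"
    and V :: "'v set" and u v :: 'v and c :: "'v set \<Rightarrow> 'g::ab_group_add" and F0 +
  assumes \<kappa>uv: "\<kappa> u = \<kappa> v" and saturated_supp: "F \<in> supp c \<Longrightarrow> saturated F"
    and IH: "\<And>e :: 'v set \<Rightarrow> 'g. is_min_cycle V e \<Longrightarrow> supp e \<noteq> {} \<Longrightarrow> (\<And>F. F \<in> supp e \<Longrightarrow> saturated F) \<Longrightarrow>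
       \<Union>(supp e) \<subseteq> \<Union>(supp c) - {u} \<Longrightarrow> generic (\<lambda>x. rigid (\<Union>(supp e)) (edge_pairs (supp e)) (sparsify x))"
begin

text \<open>No face of a piece contains both \<open>u\<close> and \<open>v\<close>, but splitting
  needs their edge; \<open>F0\<close> ensures that it is an edge of the whole complex.\<close>

definition piece_edges where "piece_edges B = edge_pairs B \<union> {(u, v), (v, u)}"

lemma piece_saturated: "B \<subseteq> \<S> \<Longrightarrow> F \<in> B \<Longrightarrow> saturated F"
  using saturated_supp \<S>_sub by blast

lemma piece_vertices:
  assumes B: "B \<subseteq> \<S>" "contr_cycle B" and K: "K \<subseteq> V" "u \<notin> K" "v \<notin> K" "\<beta> B K \<noteq> 0"
  shows "insert u (insert v K) \<subseteq> \<Union>B" "w \<in> K \<Longrightarrow> (u, w) \<in> piece_edges B \<and> (v, w) \<in> piece_edges B"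
proof -
  obtain y y' where y: "insert y (insert u K) \<in> B" "insert y' (insert v K) \<in> B"
    using \<beta>_faces[OF B K] by blast
  then show "insert u (insert v K) \<subseteq> \<Union>B" by blast
  show "(u, w) \<in> piece_edges B \<and> (v, w) \<in> piece_edges B" if "w \<in> K"
    unfolding piece_edges_def edge_pairs_def
    using bexI[OF _ y(1), of "\<lambda>F. u \<in> F \<and> w \<in> F"] bexI[OF _ y(2), of "\<lambda>F. v \<in> F \<and> w \<in> F"] that
    by simp
qed

text \<open>If \<open>K \<union> {u, v}\<close> is not saturated, it lacks one vertex of some color \<open>j \<noteq> \<kappa> u\<close>. As color \<open>j\<close>
  occurs at least twice in a facet, some \<open>w \<in> K\<close> has color \<open>j\<close>, and its substitute \<open>w'\<close> must then
  have color \<open>j\<close> too.\<close>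

lemma common_neighbours:
  assumes B: "B \<subseteq> \<S>" "contr_cycle B" and K: "K \<subseteq> V" "u \<notin> K" "v \<notin> K" "\<beta> B K \<noteq> 0"
  obtains w w' A where "w \<in> K" "w' \<in> V" "w' \<notin> K" "w' \<noteq> u" "w' \<noteq> v" "\<beta> B (insert w' (K - {w})) \<noteq> 0"
    "saturated A" "A = insert u (insert w' K) \<or> A = insert u (insert v K)"
proof -
  have face: "\<exists>y. y \<notin> insert u K' \<and> saturated (insert y (insert u K'))"
    if "K' \<subseteq> V" "u \<notin> K'" "v \<notin> K'" "\<beta> B K' \<noteq> 0" for K'
    using \<beta>_faces(1)[OF B that] piece_saturated[OF B(1)] by blast
  obtain y where y: "y \<notin> insert u K" "saturated (insert y (insert u K))" using face[OF K] by blast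
  have fK: "finite K" using fin[OF K(1)] .
  show thesis
  proof (cases "\<kappa> y = \<kappa> u")
    case True
    \<comment> \<open>The bound d \<ge> 3 makes \<open>K\<close> nonempty. Any \<open>w\<close> will
      do here, because \<open>y\<close> has the color of \<open>v\<close> and so \<open>K\<close>
      with \<open>u\<close> and \<open>v\<close> is saturated.\<close>
    have "card K = d - 2" using saturated_card[OF y(2)] y(1) K(2) fK by simp
    then obtain w where w: "w \<in> K" using d3 by fastforce
    obtain w' where w': "w' \<in> V" "w' \<notin> K" "w' \<noteq> u" "w' \<noteq> v" "\<beta> B (insert w' (K - {w})) \<noteq> 0"
      using \<beta>_exchange[OF B K w] by blast
    have "saturated (insert v (insert u K))"
      using y(2) saturated_insert_iff[of "insert u K" y v] True \<kappa>uv y(1) K uv fK by auto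
    then show thesis using that[OF w w', of "insert u (insert v K)"] by (simp add: insert_commute)
  next
    case False
    have cK: "color_count (insert y (insert u K)) i = color_count K i + (if \<kappa> u = i then 1 else 0) + (if \<kappa> y = i then 1 else 0)" for i
      using y(1) K fK by (simp add: color_count_insert)
    have "color_count (insert y (insert u K)) (\<kappa> y) \<noteq> 1" using y(2) no_single unfolding saturated_def by simp
    then have "color_count K (\<kappa> y) \<noteq> 0" using cK[of "\<kappa> y"] False by simp
    then obtain w where w: "w \<in> K" "\<kappa> w = \<kappa> y" unfolding color_count_def by (auto simp: card_eq_0_iff)
    obtain w' where w': "w' \<in> V" "w' \<notin> K" "w' \<noteq> u" "w' \<noteq> v" "\<beta> B (insert w' (K - {w})) \<noteq> 0"
      using \<beta>_exchange[OF B K w(1)] by blast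
    define L where "L = K - {w}"
    have L: "finite L" "w \<notin> L" "K = insert w L" "w' \<notin> L" "u \<notin> insert w' L" "v \<notin> insert w' L"
      "insert w' L \<subseteq> V"
      using w(1) w' fK K unfolding L_def by auto
    obtain y2 where y2: "y2 \<notin> insert u (insert w' L)" "saturated (insert y2 (insert u (insert w' L)))"
      using face[of "insert w' L"] L w' unfolding L_def by blast
    \<comment> \<open>Besides \<open>L\<close>, the face through \<open>y\<close> has two vertices
      of color \<open>\<kappa> y\<close>, namely \<open>y\<close> and \<open>w\<close>. The new face
      needs two as well, and as \<open>u\<close> has another color they can only be
      \<open>y2\<close> and \<open>w'\<close>.\<close>
    have "color_count (insert y2 (insert u (insert w' L))) (\<kappa> y) = color_count (insert y (insert u K)) (\<kappa> y)"
      using y2 y unfolding saturated_def by simp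
    then have "\<kappa> w' = \<kappa> y"
      using L y2(1) False w(2) unfolding cK by (auto simp: color_count_insert split: if_splits)
    then have "saturated (insert w' (insert u K))"
      using y saturated_insert_iff[of "insert u K" y w'] w' fK by auto
    then show thesis using that[OF w(1) w', of "insert u (insert w' K)"] by (simp add: insert_commute)
  qed
qed

lemma saturated_\<pi>:
  assumes "saturated F" "\<not> (u \<in> F \<and> v \<in> F)"
  shows "saturated (\<pi> F)"
proof (cases "u \<in> F")
  case True
  then have "F = insert u (F - {u})" "u \<notin> F - {u}" "v \<notin> F - {u}" "finite (F - {u})"
    using assms unfolding saturated_def by auto
  then show ?thesis using assms(1) True saturated_insert_iff[of "F - {u}" u v] \<kappa>uv unfolding \<pi>_def by simp
next
  case False
  then show ?thesis using assms(1) unfolding \<pi>_def by simp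
qed

text \<open>Splitting uses d - 1 common neighbours: the vertices of \<open>K\<close>, and
  \<open>w'\<close>, which is adjacent to \<open>u\<close> and \<open>v\<close> through the
  exchanged face \<open>insert w' (K - {w})\<close>.\<close>

lemma generic_rigid_piece:
  assumes "piece B"
  shows "generic (\<lambda>x. rigid (\<Union>B) (piece_edges B) (sparsify x))"
proof -
  have B: "B \<subseteq> \<S>" "contr_cycle B" "B \<noteq> {}" using assms unfolding piece_def by auto
  have offuv: "\<not> (u \<in> F \<and> v \<in> F)" if "F \<in> B" for F using that B(1) unfolding \<S>_def by auto
  obtain K where K: "K \<subseteq> V" "u \<notin> K" "v \<notin> K" "\<beta> B K \<noteq> 0" using piece_\<beta>[OF assms] by blast
  obtain w w' A where w: "w \<in> K" "w' \<in> V" "w' \<notin> K" "w' \<noteq> u" "w' \<noteq> v" "\<beta> B (insert w' (K - {w})) \<noteq> 0"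
    and A: "saturated A" "A = insert u (insert w' K) \<or> A = insert u (insert v K)"
    by (rule common_neighbours[OF B(1,2) K])
  let ?W = "insert w' K"
  let ?p = "\<lambda>w. if w = u then v else w"
  obtain F where F: "F \<in> B" using B(3) by blast
  have balF: "saturated F" using piece_saturated[OF B(1) F] .
  have pF: "?p ` G = \<pi> G" if "G \<in> B" for G
    using offuv[OF that] unfolding \<pi>_def by auto
  have BV: "\<Union>B \<subseteq> V" using B(1) \<S>_sub supp_sub by blast
  show ?thesis
  proof (rule generic_rigid_split[where u = u and v = v and V' = "\<Union>(\<pi> ` B)" and E' = "edge_pairs (\<pi> ` B)"
        and W = ?W and F = F])
    show "finite (\<Union>B)" using fin[OF BV] .
    have "u \<in> \<Union>B" "v \<in> \<Union>B" using piece_vertices(1)[OF B(1,2) K] by auto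
    then show "piece_edges B \<subseteq> \<Union>B \<times> \<Union>B" unfolding piece_edges_def edge_pairs_def by auto
    show "u \<noteq> v" by (rule uv)
    show "\<kappa> u = \<kappa> v" by (rule \<kappa>uv)
    show "(u, v) \<in> piece_edges B" unfolding piece_edges_def by simp
    show "?p ` \<Union>B \<subseteq> \<Union>(\<pi> ` B)" using pF by blast
    show "\<exists>(a', b')\<in>piece_edges B. a = ?p a' \<and> b = ?p b'" if ab: "(a, b) \<in> edge_pairs (\<pi> ` B)" for a b
    proof -
      obtain G where "G \<in> B" "a \<in> \<pi> G" "b \<in> \<pi> G" using ab unfolding edge_pairs_def by blast
      then have G: "G \<in> B" "a \<in> ?p ` G" "b \<in> ?p ` G" unfolding pF[OF \<open>G \<in> B\<close>] by simp_all
      obtain a' where a': "a' \<in> G" "a = ?p a'" using G(2) by (rule imageE)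
      obtain b' where b': "b' \<in> G" "b = ?p b'" using G(3) by (rule imageE)
      have "(a', b') \<in> piece_edges B" using a'(1) b'(1) G(1) unfolding piece_edges_def edge_pairs_def by auto
      then show ?thesis by (rule bexI[rotated]) (use a'(2) b'(2) in simp)
    qed
    show "u \<notin> ?W" "v \<notin> ?W" using K w by auto
    have K': "insert w' (K - {w}) \<subseteq> V" "u \<notin> insert w' (K - {w})" "v \<notin> insert w' (K - {w})"
      using K w by auto
    show "(u, z) \<in> piece_edges B \<and> (v, z) \<in> piece_edges B" if "z \<in> ?W" for z
      using that piece_vertices(2)[OF B(1,2) K] piece_vertices(2)[OF B(1,2) K' w(6)] by blast
    show "generic (\<lambda>x. splitting ?W u v (sparsify x))"
    proof -
      obtain \<phi> where \<phi>: "fits \<phi> A" using saturated_fits[OF A(1)] by blast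
      show ?thesis
        by (rule generic_splitting[OF _ \<phi> saturated_card[OF A(1)]]) (use A(2) K w uv fin[OF K(1)] in auto)
    qed
    show "F \<subseteq> \<Union>B" using F by blast
    show "card F = d" using saturated_card[OF balF] .
    show "F \<times> F \<subseteq> piece_edges B" using F unfolding piece_edges_def edge_pairs_def by auto
    show "generic (\<lambda>x. spanning F (sparsify x))" using generic_spanning_saturated[OF balF] .
    show "generic (\<lambda>x. nondeg (?p ` F) (sparsify x))"
    proof -
      have "saturated (\<pi> F)" using saturated_\<pi>[OF balF offuv[OF F]] .
      moreover from this have "\<pi> F \<noteq> {}" using saturated_card d3 by fastforce
      ultimately show ?thesis
        unfolding pF[OF F] using generic_nondeg_saturated[of "\<pi> F" "\<pi> F"] saturated_card[of "\<pi> F"]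
        unfolding saturated_def by blast
    qed
    show "generic (\<lambda>x. rigid (\<Union>(\<pi> ` B)) (edge_pairs (\<pi> ` B)) (sparsify x))"
      using assms
    proof (cases rule: piece_contraction)
      case (simplex G)
      then have "G = \<pi> F" using F by auto
      then have "saturated G" using saturated_\<pi>[OF balF offuv[OF F]] by simp
      then show ?thesis unfolding simplex using generic_rigid_saturated by simp
    next
      case cycle
      show ?thesis
        unfolding cycle(2)[symmetric]
      proof (rule IH[OF cycle(1)])
        show "supp (contr (restrict c B)) \<noteq> {}" unfolding cycle(2) using B(3) by simp
        show "saturated G" if "G \<in> supp (contr (restrict c B))" for G
          using that unfolding cycle(2) using saturated_\<pi> offuv piece_saturated[OF B(1)] by auto
        have "v \<in> \<Union>(supp c)" using F0 by blast
        moreover have "\<Union>B \<subseteq> \<Union>(supp c)" using B(1) \<S>_sub by blast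
        ultimately show "\<Union>(supp (contr (restrict c B))) \<subseteq> \<Union>(supp c) - {u}"
          unfolding cycle(2) \<pi>_def using uv by (auto split: if_splits)
      qed
    qed
  qed
qed

text \<open>The pieces on which a given motion vanishes propagate: two pieces with a common \<open>\<beta>\<close>-face
  \<open>K\<close> share the affinely independent set \<open>K \<union> {u, v}\<close>.\<close>

lemma generic_rigid_step: "generic (\<lambda>x. rigid (\<Union>(supp c)) (edge_pairs (supp c)) (sparsify x))"
proof -
  \<comment> \<open>All sets over which pieces may have to be glued. The collection is finite and
    does not depend on the configuration, so nondegeneracy can be demanded for all of them at
    once.\<close>
  define \<K> where "\<K> = {K. K \<subseteq> V \<and> u \<notin> K \<and> v \<notin> K \<and> (\<exists>y. y \<notin> insert u K \<and> saturated (insert y (insert u K)))}"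
  have "finite {B. piece B}"
    by (rule finite_subset[of _ "Pow \<S>"]) (use finite_\<S> in \<open>auto simp: piece_def\<close>)
  then have 1: "generic (\<lambda>x. \<forall>B\<in>{B. piece B}. rigid (\<Union>B) (piece_edges B) (sparsify x))"
    by (rule generic_Ball) (simp add: generic_rigid_piece)
  have "finite \<K>" by (rule finite_subset[of _ "Pow V"]) (use V in \<open>auto simp: \<K>_def\<close>)
  then have 2: "generic (\<lambda>x. \<forall>K\<in>\<K>. nondeg (insert u (insert v K)) (sparsify x))"
  proof (rule generic_Ball)
    fix K assume "K \<in> \<K>"
    then obtain y where K: "K \<subseteq> V" "u \<notin> K" "v \<notin> K" and y: "y \<notin> insert u K" "saturated (insert y (insert u K))"
      unfolding \<K>_def by blast
    show "generic (\<lambda>x. nondeg (insert u (insert v K)) (sparsify x))"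
    proof (rule generic_nondeg_saturated[OF y(2), where ?f0.0 = v])
      show "card (insert u (insert v K)) = d"
        using saturated_card[OF y(2)] y(1) K fin[OF K(1)] uv by simp
    qed (use fin[OF K(1)] K in auto)
  qed
  from generic_conj[OF 1 2] show ?thesis
  proof (rule generic_mono)
    fix x assume "(\<forall>B\<in>{B. piece B}. rigid (\<Union>B) (piece_edges B) (sparsify x)) \<and>
      (\<forall>K\<in>\<K>. nondeg (insert u (insert v K)) (sparsify x))"
    then have rigB: "\<And>B. piece B \<Longrightarrow> rigid (\<Union>B) (piece_edges B) (sparsify x)"
      and nd: "\<And>K. K \<in> \<K> \<Longrightarrow> nondeg (insert u (insert v K)) (sparsify x)" by auto
    have piece_edges_sub: "piece_edges B \<subseteq> edge_pairs (supp c)" if "piece B" for B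
      using that F0 \<S>_sub unfolding piece_edges_def edge_pairs_def piece_def by blast
    have in\<K>: "K \<in> \<K>" if "A \<subseteq> \<S>" "contr_cycle A" "K \<subseteq> V" "u \<notin> K" "v \<notin> K" "\<beta> A K \<noteq> 0" for A K
      using \<beta>_faces(1)[OF that] piece_saturated[OF that(1)] that unfolding \<K>_def by blast
    show "rigid (\<Union>(supp c)) (edge_pairs (supp c)) (sparsify x)"
      unfolding rigid_def
    proof (intro allI impI)
      fix q assume q: "motion (edge_pairs (supp c)) (sparsify x) q"
      obtain K where "\<beta> \<S> K \<noteq> 0" using \<S>_\<beta>(1) by blast
      then obtain B0 where B0: "piece B0" using piece_exists[OF order_refl contr_cycle_\<S>] by blast
      have "motion (piece_edges B0) (sparsify x) q" using q piece_edges_sub[OF B0] unfolding motion_def by blast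
      then have "\<exists>T t. skew T \<and> (\<forall>v\<in>\<Union>B0. \<forall>k<d. q v k = (\<Sum>l<d. T k l * sparsify x v l) + t k)"
        using rigB[OF B0] unfolding rigid_def by simp
      then obtain T t where T: "skew T"
        and Tt: "\<forall>v\<in>\<Union>B0. \<forall>k<d. q v k = (\<Sum>l<d. T k l * sparsify x v l) + t k" by (elim exE conjE)
      define r where "r v k = q v k - ((\<Sum>l<d. T k l * sparsify x v l) + t k)" for v k
      have r: "motion (edge_pairs (supp c)) (sparsify x) r"
        by (rule motion_diff_trivial[OF q T]) (rule r_def)
      \<comment> \<open>The trivial motion found on \<open>B0\<close> has been subtracted. A maximal
        member of \<A> turns out to satisfy the hypothesis of \<open>closed_subset_eq\<close> and is
        therefore all of \<S>.\<close>
      define \<A> where "\<A> = {A. A \<subseteq> \<S> \<and> contr_cycle A \<and> A \<noteq> {} \<and> (\<forall>a\<in>\<Union>A. \<forall>k<d. r a k = 0)}"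
      have B0A: "B0 \<in> \<A>" using B0 Tt unfolding \<A>_def piece_def r_def by simp
      have "finite \<A>" by (rule finite_subset[of _ "Pow \<S>"]) (use finite_\<S> in \<open>auto simp: \<A>_def\<close>)
      then obtain A where A\<A>: "A \<in> \<A>" and max: "\<And>A'. A' \<in> \<A> \<Longrightarrow> A \<subseteq> A' \<Longrightarrow> A = A'"
        using finite_has_maximal[of \<A>] B0A by blast
      have A: "A \<subseteq> \<S>" "contr_cycle A" "A \<noteq> {}" and A0: "\<And>a k. a \<in> \<Union>A \<Longrightarrow> k < d \<Longrightarrow> r a k = 0"
        using A\<A> unfolding \<A>_def by auto
      have closed: "\<beta> (\<S> - A) K = 0" if K: "K \<subseteq> V" "u \<notin> K" "v \<notin> K" "\<beta> A K \<noteq> 0" for K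
      proof (rule ccontr)
        assume "\<beta> (\<S> - A) K \<noteq> 0"
        then obtain B where B: "B \<subseteq> \<S> - A" "piece B" "\<beta> B K \<noteq> 0"
          using piece_exists[of "\<S> - A" K] contr_cycle_diff[OF contr_cycle_\<S> A(2,1)] by blast
        have BS: "B \<subseteq> \<S>" "contr_cycle B" "B \<noteq> {}" using B(2) unfolding piece_def by auto
        have rB: "motion (piece_edges B) (sparsify x) r" using r piece_edges_sub[OF B(2)] unfolding motion_def by blast
        have nK: "nondeg (insert u (insert v K)) (sparsify x)" using nd in\<K>[OF A(1,2) K] .
        have subA: "insert u (insert v K) \<subseteq> \<Union>A" using piece_vertices(1)[OF A(1,2) K] .
        have subB: "insert u (insert v K) \<subseteq> \<Union>B" using piece_vertices(1)[OF BS(1,2) K(1-3) B(3)] .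
        have rB0: "r a k = 0" if "a \<in> \<Union>B" "k < d" for a k
          by (rule rigid_motion_zero[OF rigB[OF B(2)] rB nK subB _ that]) (use A0 subA in blast)
        have "contr_cycle (A \<union> B)" using contr_cycle_union_iff[OF A(2), of B] B(1) BS(2) by blast
        moreover have "r a k = 0" if "a \<in> \<Union>(A \<union> B)" "k < d" for a k
          using that A0[of a k] rB0[of a k] unfolding Union_Un_distrib by blast
        ultimately have "A \<union> B \<in> \<A>" using A(1,3) BS(1) unfolding \<A>_def by blast
        then have "A = A \<union> B" by (rule max) simp
        then show False using B(1) BS(3) by blast
      qed
      have AS: "A = \<S>" by (rule closed_subset_eq[OF A closed])
      have "r a k = 0" if a: "a \<in> \<Union>(supp c)" and "k < d" for a k
      proof -
        obtain F where F: "F \<in> supp c" "a \<in> F" using a by blast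
        \<comment> \<open>The discarded faces bring in no new vertices: without \<open>u\<close> and
          \<open>v\<close> each of them is a set where \<open>\<beta> \<S>\<close> is nonzero, so
          its vertices lie on faces of \<S>.\<close>
        have "a \<in> \<Union>\<S>"
        proof (cases "u \<in> F \<and> v \<in> F")
          case True
          have "F - {u, v} \<subseteq> V" using F(1) supp_sub by blast
          then have "insert u (insert v (F - {u, v})) \<subseteq> \<Union>\<S>"
            using piece_vertices(1)[OF order_refl contr_cycle_\<S>] \<S>_\<beta>(2)[OF F(1)] True by blast
          then show ?thesis using F(2) by blast
        next
          case False
          then show ?thesis using F unfolding \<S>_def by blast
        qed
        then show ?thesis using A0 AS \<open>k < d\<close> by blast
      qed
      then have "\<forall>v\<in>\<Union>(supp c). \<forall>k<d. q v k = (\<Sum>l<d. T k l * sparsify x v l) + t k"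
        unfolding r_def by simp
      with T show "\<exists>\<S> t. skew \<S> \<and> (\<forall>v\<in>\<Union>(supp c). \<forall>k<d. q v k = (\<Sum>l<d. \<S> k l * sparsify x v l) + t k)"
        by blast
    qed
  qed
qed

end

section \<open>Induction on the number of vertices\<close>

context colored_order
begin

lemma generic_rigid_min_cycle:
  fixes c :: "'v set \<Rightarrow> 'g::ab_group_add"
  assumes "finite V" "is_min_cycle V c" "supp c \<noteq> {}" "\<And>F. F \<in> supp c \<Longrightarrow> saturated F"
  shows "generic (\<lambda>x. rigid (\<Union>(supp c)) (edge_pairs (supp c)) (sparsify x))"
  using assms(2-)
proof (induction "card (\<Union>(supp c))" arbitrary: c rule: less_induct)
  case less
  obtain F where F: "F \<in> supp c" using less.prems by blast
  then have F': "saturated F" "F \<subseteq> V" using less.prems unfolding is_min_cycle_def by auto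
  have "F \<noteq> {}" using saturated_card[OF F'(1)] d3 by auto
  then obtain u where u: "u \<in> F" by blast
  then obtain v where v: "v \<in> F" "v \<noteq> u" "\<kappa> v = \<kappa> u" using saturated_same_color[OF F'(1)] by blast
  have fin: "finite (\<Union>(supp c))"
    by (rule finite_subset[OF _ assms(1)]) (use less.prems(1) in \<open>auto simp: is_min_cycle_def\<close>)
  interpret colored_cycle d col \<kappa> V u v c F
  proof
    fix e :: "'v set \<Rightarrow> 'g"
    assume e: "is_min_cycle V e" "supp e \<noteq> {}" "\<And>F. F \<in> supp e \<Longrightarrow> saturated F"
      "\<Union>(supp e) \<subseteq> \<Union>(supp c) - {u}"
    have "\<Union>(supp e) \<subset> \<Union>(supp c)" using e(4) u F by blast
    then have "card (\<Union>(supp e)) < card (\<Union>(supp c))" using fin psubset_card_mono by blast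
    then show "generic (\<lambda>x. rigid (\<Union>(supp e)) (edge_pairs (supp e)) (sparsify x))"
      by (rule less.hyps[OF _ e(1-3)])
  qed (use assms(1) less.prems F F' u v in auto)
  show ?case by (rule generic_rigid_step)
qed

end

section \<open>Translation to complexes and real vectors\<close>

text \<open>The terms are regrouped by the vertex x that extends \<open>G\<close> to a face. The
  minus sign arises because the position of x, counted with \<le>, includes x itself.\<close>

lemma lookup_boundary:
  fixes c :: "'v::linorder set \<Rightarrow>\<^sub>0 'g::ab_group_add"
  assumes V: "finite V" "Poly_Mapping.keys c \<subseteq> Pow V"
  shows "Poly_Mapping.lookup (boundary c) G = - bdry V (Poly_Mapping.lookup c) G"
proof -
  define h where "h F x = (if even (card {y \<in> F. y \<le> x}) then Poly_Mapping.lookup c F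
           else - Poly_Mapping.lookup c F)" for F x
  have h: "h (insert x G) x = - signed (even_pos x G) (Poly_Mapping.lookup c (insert x G))"
    if "x \<notin> G" "finite G" for x
  proof -
    have "{y \<in> insert x G. y \<le> x} = insert x {y \<in> G. y < x}" using that by auto
    then show ?thesis unfolding h_def even_pos_def signed_def using that by simp
  qed
  have "Poly_Mapping.lookup (boundary c) G =
      (\<Sum>F\<in>Poly_Mapping.keys c. \<Sum>x\<in>F. if F - {x} = G then h F x else 0)"
    unfolding boundary_def h_def lookup_sum by (simp add: lookup_single when_def)
  also have "\<dots> = (\<Sum>F\<in>Poly_Mapping.keys c. \<Sum>x\<in>V. if x \<notin> G \<and> F = insert x G then h F x else 0)"
  proof (rule sum.cong)
    fix F assume "F \<in> Poly_Mapping.keys c"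
    then have F: "F \<subseteq> V" using V by auto
    have eq: "x \<in> F \<and> F - {x} = G \<longleftrightarrow> x \<notin> G \<and> F = insert x G" for x by auto
    have "(\<Sum>x\<in>F. if F - {x} = G then h F x else 0) = (\<Sum>x\<in>F. if x \<notin> G \<and> F = insert x G then h F x else 0)"
      using eq by (intro sum.cong) auto
    also have "\<dots> = (\<Sum>x\<in>V. if x \<notin> G \<and> F = insert x G then h F x else 0)"
      using F V(1) by (intro sum.mono_neutral_left) auto
    finally show "(\<Sum>x\<in>F. if F - {x} = G then h F x else 0) =
        (\<Sum>x\<in>V. if x \<notin> G \<and> F = insert x G then h F x else 0)" .
  qed simp
  also have "\<dots> = (\<Sum>x\<in>V. \<Sum>F\<in>Poly_Mapping.keys c. if x \<notin> G \<and> F = insert x G then h F x else 0)"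
    by (rule sum.swap)
  also have "\<dots> = (\<Sum>x\<in>V. if x \<notin> G then - signed (even_pos x G) (Poly_Mapping.lookup c (insert x G)) else 0)"
  proof (rule sum.cong)
    fix x assume "x \<in> V"
    show "(\<Sum>F\<in>Poly_Mapping.keys c. if x \<notin> G \<and> F = insert x G then h F x else 0) =
      (if x \<notin> G then - signed (even_pos x G) (Poly_Mapping.lookup c (insert x G)) else 0)"
    proof (cases "x \<notin> G \<and> insert x G \<in> Poly_Mapping.keys c")
      case True
      then have "finite G" using V finite_subset by (metis PowD finite_insert subsetD)
      have "(\<Sum>F\<in>Poly_Mapping.keys c. if x \<notin> G \<and> F = insert x G then h F x else 0) =
          (\<Sum>F\<in>Poly_Mapping.keys c. if F = insert x G then h (insert x G) x else 0)"
        using True by (intro sum.cong) auto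
      also have "\<dots> = h (insert x G) x" using True by simp
      finally show ?thesis using h \<open>finite G\<close> True by simp
    next
      case False
      then have "(\<Sum>F\<in>Poly_Mapping.keys c. if x \<notin> G \<and> F = insert x G then h F x else 0) = 0"
        by (intro sum.neutral) auto
      then show ?thesis using False by (auto simp: in_keys_iff)
    qed
  qed simp
  also have "\<dots> = (\<Sum>x\<in>V - G. - signed (even_pos x G) (Poly_Mapping.lookup c (insert x G)))"
    using V(1) by (intro sum.mono_neutral_cong_right) auto
  finally show ?thesis unfolding bdry_def by (simp add: sum_negf)
qed

text \<open>A set \<open>A\<close> of faces of \<open>c\<close> is turned into the formal sum
  \<open>c'\<close> with support \<open>A\<close>, to which the minimality of \<open>c\<close>
  applies.\<close>

lemma is_min_cycle_lookup:
  fixes c :: "'v::linorder set \<Rightarrow>\<^sub>0 'g::ab_group_add"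
  assumes V: "finite V" "Poly_Mapping.keys c \<subseteq> Pow V" and c: "minimal_cycle i c"
  shows "is_min_cycle V (Poly_Mapping.lookup c)" "supp (Poly_Mapping.lookup c) = Poly_Mapping.keys c"
proof -
  show s: "supp (Poly_Mapping.lookup c) = Poly_Mapping.keys c"
    unfolding supp_def by (auto simp: in_keys_iff)
  show "is_min_cycle V (Poly_Mapping.lookup c)"
    unfolding is_min_cycle_def s
  proof (intro conjI allI impI)
    show "Poly_Mapping.keys c \<subseteq> Pow V" by (rule V(2))
    have "boundary c = 0" using c unfolding minimal_cycle_def cycle_def by blast
    then have "bdry V (Poly_Mapping.lookup c) G = 0" for G
      using lookup_boundary[OF V, of G] by simp
    then show "is_cycle V (Poly_Mapping.lookup c)" unfolding is_cycle_def by blast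
    fix A assume A: "A \<subseteq> Poly_Mapping.keys c" and is_cycle: "is_cycle V (restrict (Poly_Mapping.lookup c) A)"
    define c' where "c' = (\<Sum>F\<in>A. Poly_Mapping.single F (Poly_Mapping.lookup c F))"
    have fA: "finite A" by (rule finite_subset[OF A finite_keys])
    have l: "Poly_Mapping.lookup c' = restrict (Poly_Mapping.lookup c) A"
    proof
      fix F
      have "Poly_Mapping.lookup c' F = (\<Sum>F'\<in>A. if F' = F then Poly_Mapping.lookup c F else 0)"
        unfolding c'_def lookup_sum by (intro sum.cong) (auto simp: lookup_single when_def)
      then show "Poly_Mapping.lookup c' F = restrict (Poly_Mapping.lookup c) A F"
        unfolding restrict_def using fA by simp
    qed
    have k: "Poly_Mapping.keys c' = A"
      using A unfolding l restrict_def by (auto simp: in_keys_iff l restrict_def split: if_splits)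
    have "boundary c' = 0"
    proof (rule poly_mapping_eqI)
      fix G
      have "bdry V (restrict (Poly_Mapping.lookup c) A) G = 0"
      proof (cases "G \<subseteq> V")
        case True
        then show ?thesis using is_cycle unfolding is_cycle_def by blast
      next
        case False
        then have "insert x G \<notin> A" for x using A V(2) by blast
        then show ?thesis unfolding bdry_def restrict_def by simp
      qed
      then show "Poly_Mapping.lookup (boundary c') G = Poly_Mapping.lookup 0 G"
        using lookup_boundary[OF V(1), of c' G] A V(2) unfolding l k by simp
    qed
    moreover have "chain i c'" using c A unfolding minimal_cycle_def cycle_def chain_def k by blast
    moreover have "subchain c' c" unfolding subchain_def l restrict_def by simp
    ultimately have "c' = c \<or> c' = 0" using c unfolding minimal_cycle_def cycle_def by blast
    then show "A = {} \<or> A = Poly_Mapping.keys c" using k by auto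
  qed
qed

section \<open>Blocks of coordinates as color classes\<close>

definition coord_color :: "(nat \<Rightarrow> nat) \<Rightarrow> nat \<Rightarrow> nat" where
  "coord_color a k = (LEAST i. k < (\<Sum>j=1..i. a j))"

lemma coord_color_block:
  assumes "1 \<le> i" "k \<in> block a i"
  shows "coord_color a k = i"
  unfolding coord_color_def
proof (rule Least_equality)
  show "k < (\<Sum>j=1..i. a j)" using assms(2) unfolding block_def by simp
  fix i' assume i': "k < (\<Sum>j=1..i'. a j)"
  show "i \<le> i'"
  proof (rule ccontr)
    assume "\<not> i \<le> i'"
    then have "(\<Sum>j=1..i'. a j) \<le> (\<Sum>j=1..<i. a j)" by (intro sum_mono2) auto
    then show False using i' assms(2) unfolding block_def by simp
  qed
qed

lemma coord_color_in_block:
  assumes "k < (\<Sum>j=1..m. a j)"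
  shows "coord_color a k \<in> {1..m}" "k \<in> block a (coord_color a k)"
proof -
  let ?i = "coord_color a k"
  have lt: "k < (\<Sum>j=1..?i. a j)" unfolding coord_color_def using assms by (rule LeastI)
  then have pos: "1 \<le> ?i" by (cases "?i") auto
  have "?i \<le> m" unfolding coord_color_def using assms by (rule Least_le)
  with pos show "?i \<in> {1..m}" by simp
  have "\<not> k < (\<Sum>j=1..?i - 1. a j)"
    using pos unfolding coord_color_def by (intro not_less_Least) simp
  moreover have "{1..<?i} = {1..?i - 1}" using pos by auto
  ultimately show "k \<in> block a ?i" using lt unfolding block_def by simp
qed

lemma coord_color_class:
  assumes "i \<in> {1..m}"
  shows "{k. k < (\<Sum>j=1..m. a j) \<and> coord_color a k = i} = block a i"
proof -
  have "(\<Sum>j=1..i. a j) \<le> (\<Sum>j=1..m. a j)" using assms by (intro sum_mono2) auto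
  then have "k < (\<Sum>j=1..m. a j)" if "k \<in> block a i" for k using that unfolding block_def by simp
  then show ?thesis using assms coord_color_block[of i _ a] coord_color_in_block(2)[of _ a m] by auto
qed

lemma card_block:
  assumes "1 \<le> i"
  shows "card (block a i) = a i"
proof -
  have "{1..i} = insert i {1..<i}" using assms by auto
  then show ?thesis unfolding block_def by simp
qed

lemma card_coord_color_class:
  "card {k. k < (\<Sum>j=1..m. a j) \<and> coord_color a k = i} = (if i \<in> {1..m} then a i else 0)"
proof (cases "i \<in> {1..m}")
  case True
  then show ?thesis using coord_color_class[OF True] card_block[of i a] by simp
next
  case False
  then have empty: "{k. k < (\<Sum>j=1..m. a j) \<and> coord_color a k = i} = {}"
    using coord_color_in_block(1)[of _ a m] by blast
  show ?thesis unfolding empty using False by (simp only: if_False card.empty)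
qed

theorem theorem6p1:
  fixes m d :: nat and a :: "nat \<Rightarrow> nat"
    and \<Delta> :: "'v::linorder set set" and \<kappa> :: "'v \<Rightarrow> nat"
  assumes "\<forall>i\<in>{1..m}. 2 \<le> a i"
    and "d = (\<Sum>i=1..m. a i)"
    and "3 \<le> d"
    and "balanced m a \<Delta>"
    and "minimal_cycle_complex TYPE('g::ab_group_add) (d - 1) \<Delta>"
    and "coloring m a \<Delta> \<kappa>"
  shows "sparse_rigid m a \<kappa> (graph_of \<Delta>)"
proof -
  have class_card: "card {k. k < d \<and> coord_color a k = i} = (if i \<in> {1..m} then a i else 0)" for i
    unfolding assms(2) by (rule card_coord_color_class)
  interpret colored_order d "coord_color a" \<kappa>
  proof
    show "3 \<le> d" by (rule assms(3))
    show "card {k. k < d \<and> coord_color a k = i} \<noteq> 1" for i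
      using bspec[OF assms(1), of i] unfolding class_card
      by (cases "i \<in> {1..m}") auto
  qed
  have fin\<Delta>: "finite \<Delta>" "\<And>F. F \<in> \<Delta> \<Longrightarrow> finite F"
    using assms(4) unfolding balanced_def complex_of_dim_def simplicial_complex_def by auto
  \<comment> \<open>The color counts of a d-set are bounded by the \<open>a i\<close> and have the
    same total d, so every bound is attained.\<close>
  have saturated: "saturated F" if F: "F \<in> \<Delta>" "card F = d" "\<And>f. f \<in> F \<Longrightarrow> {f} \<in> \<Delta>" for F
  proof -
    have fF: "finite F" using fin\<Delta>(2) F(1) by blast
    have \<kappa>F: "\<kappa> ` F \<subseteq> {1..m}"
      using assms(6) F(3) unfolding coloring_def vertices_def by auto
    have color_count: "color_count F i = card (F \<inter> \<kappa> -` {i})" for i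
      unfolding color_count_def by (rule arg_cong[of _ _ card]) auto
    have "(\<Sum>i=1..m. color_count F i) = card F"
      unfolding color_count_def using sum.group[OF fF _ \<kappa>F, of "\<lambda>_. 1::nat"] by simp
    then have "(\<Sum>i=1..m. color_count F i) = (\<Sum>i=1..m. a i)" using F(2) assms(2) by simp
    moreover have "\<And>i. i \<in> {1..m} \<Longrightarrow> color_count F i \<le> a i"
      using assms(6) F(1) unfolding coloring_def color_count by blast
    ultimately have "\<And>i. i \<in> {1..m} \<Longrightarrow> color_count F i = a i"
      by (intro sum_mono_inv[of "color_count F" "{1..m}" a]) auto
    moreover have "color_count F i = 0" if "i \<notin> {1..m}" for i
      using that \<kappa>F unfolding color_count_def by (auto simp: card_eq_0_iff)
    ultimately show ?thesis unfolding saturated_def class_card using fF by auto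
  qed
  obtain \<F> where \<F>: "\<Delta> = generated \<F>" and gen: "generic (\<lambda>x. rigid (\<Union>\<F>) (edge_pairs \<F>) (sparsify x))"
  proof -
    have cl: "\<And>F f. F \<in> \<Delta> \<Longrightarrow> f \<in> F \<Longrightarrow> {f} \<in> \<Delta>"
      using assms(4) unfolding balanced_def complex_of_dim_def simplicial_complex_def by blast
    have d: "Suc (d - 1) = d" using assms(3) by simp
    consider F where "card F = d" "\<Delta> = generated {F}"
      | c :: "'v set \<Rightarrow>\<^sub>0 'g" where "c \<noteq> 0" "minimal_cycle (d - 1) c" "\<Delta> = generated (Poly_Mapping.keys c)"
      using assms(5) unfolding minimal_cycle_complex_def d by blast
    then show thesis
    proof cases
      case 1
      then have "F \<in> \<Delta>" unfolding generated_def by blast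
      then have "saturated F" using saturated cl 1(1) by blast
      then show thesis using that[OF 1(2)] generic_rigid_saturated by simp
    next
      case 2
      let ?c = "Poly_Mapping.lookup c" and ?V = "\<Union>(Poly_Mapping.keys c)"
      have k\<Delta>: "F \<in> \<Delta>" if "F \<in> Poly_Mapping.keys c" for F
        using that unfolding 2(3) generated_def by blast
      have card: "card F = d" if "F \<in> Poly_Mapping.keys c" for F
        using that 2(2) d unfolding minimal_cycle_def cycle_def chain_def by simp
      have V: "finite ?V" "Poly_Mapping.keys c \<subseteq> Pow ?V"
        using k\<Delta> fin\<Delta>(2) by auto
      note mc = is_min_cycle_lookup[OF V 2(2)]
      have "generic (\<lambda>x. rigid (\<Union>(supp ?c)) (edge_pairs (supp ?c)) (sparsify x))"
        by (rule generic_rigid_min_cycle[OF V(1) mc(1)])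
          (use 2(1) saturated[OF k\<Delta> card cl[OF k\<Delta>]] in \<open>auto simp: mc(2)\<close>)
      then show thesis using that[OF 2(3)] unfolding mc(2) by blast
    qed
  qed
  obtain x where x: "rigid (\<Union>\<F>) (edge_pairs \<F>) (sparsify x)" using generic_exists[OF gen] by blast
  define p where "p v = vec d (sparsify x v)" for v
  have vert: "vertices \<Delta> = \<Union>\<F>" unfolding vertices_def \<F> generated_def by auto
  have p: "p v \<in> carrier_vec d" for v unfolding p_def by simp
  have "sparse m a \<kappa> (graph_of \<Delta>) p"
  proof -
    have "p v \<in> H m a (\<kappa> v)" for v
      unfolding H_def
    proof (intro CollectI conjI ballI impI)
      show "p v \<in> carrier_vec (\<Sum>j=1..m. a j)" using p unfolding assms(2) .
      fix j k assume j: "j \<in> {1..m}" "j \<noteq> \<kappa> v" and k: "k \<in> block a j"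
      have "k < d" using coord_color_class[OF j(1), of a] k unfolding assms(2) by blast
      moreover have "coord_color a k = j" using coord_color_block k j(1) by simp
      ultimately show "p v $ k = 0" using j(2) unfolding p_def sparsify_def by simp
    qed
    then show ?thesis unfolding graph_of_def by simp
  qed
  moreover have "infinitesimally_rigid d (graph_of \<Delta>) p"
    unfolding infinitesimally_rigid_def
  proof (intro conjI allI impI)
    have "(\<lambda>v. {v}) ` vertices \<Delta> \<subseteq> \<Delta>" unfolding vertices_def by auto
    then have "finite ((\<lambda>v. {v}) ` vertices \<Delta>)" using fin\<Delta>(1) finite_subset by blast
    then have "finite (vertices \<Delta>)" by (rule finite_imageD) simp
    moreover have "e \<subseteq> vertices \<Delta>" if "e \<in> \<Delta>" for e
      using that unfolding \<F> vertices_def generated_def by auto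
    ultimately show "framework d (graph_of \<Delta>) p" unfolding graph_of_def using p by simp
    fix q assume "infinitesimal_motion d (graph_of \<Delta>) p q"
    then have q: "\<And>v. v \<in> \<Union>\<F> \<Longrightarrow> q v \<in> carrier_vec d"
      and qE: "\<And>u v. {u, v} \<in> \<Delta> \<Longrightarrow> card {u, v} = 2 \<Longrightarrow> (p u - p v) \<bullet> (q u - q v) = 0"
      unfolding graph_of_def vert by auto
    have "motion (edge_pairs \<F>) (sparsify x) (\<lambda>v k. q v $ k)"
      unfolding motion_def
    proof (intro ballI, clarify)
      fix u v assume "(u, v) \<in> edge_pairs \<F>"
      then obtain F where F: "F \<in> \<F>" "u \<in> F" "v \<in> F" unfolding edge_pairs_def by blast
      show "(\<Sum>k<d. (sparsify x u k - sparsify x v k) * (q u $ k - q v $ k)) = 0"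
      proof (cases "u = v")
        case False
        have "{u, v} \<in> \<Delta>" using F unfolding \<F> generated_def by auto
        then have "(p u - p v) \<bullet> (q u - q v) = 0" using qE False by simp
        moreover have "q u \<in> carrier_vec d" "q v \<in> carrier_vec d" using q F by auto
        ultimately show ?thesis
          unfolding p_def scalar_prod_def by (simp add: lessThan_atLeast0)
      qed simp
    qed
    then have "\<exists>S t. skew S \<and> (\<forall>v\<in>\<Union>\<F>. \<forall>k<d. q v $ k = (\<Sum>l<d. S k l * sparsify x v l) + t k)"
      using x unfolding rigid_def by simp
    then obtain S t where S: "skew S"
      and St: "\<forall>v\<in>\<Union>\<F>. \<forall>k<d. q v $ k = (\<Sum>l<d. S k l * sparsify x v l) + t k" by (elim exE conjE)
    let ?S = "mat d d (\<lambda>(k, l). S k l)" and ?t = "vec d t"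
    have "transpose_mat ?S = - ?S"
    proof (rule eq_matI)
      fix i j assume "i < dim_row (- ?S)" "j < dim_col (- ?S)"
      then have ij: "i < d" "j < d" by simp_all
      then have "S j i = - S i j" using S unfolding skew_def by blast
      then show "transpose_mat ?S $$ (i, j) = (- ?S) $$ (i, j)" using ij by simp
    qed simp_all
    moreover have "q v = ?S *\<^sub>v p v + ?t" if "v \<in> \<Union>\<F>" for v
    proof (rule eq_vecI)
      show "dim_vec (q v) = dim_vec (?S *\<^sub>v p v + ?t)" using q[OF that] by simp
      fix k assume "k < dim_vec (?S *\<^sub>v p v + ?t)"
      then have k: "k < d" by simp
      have "(?S *\<^sub>v p v) $ k = (\<Sum>l<d. S k l * sparsify x v l)"
        using k unfolding p_def by (simp add: scalar_prod_def lessThan_atLeast0)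
      moreover have "q v $ k = (\<Sum>l<d. S k l * sparsify x v l) + t k" using St that k by blast
      ultimately show "q v $ k = (?S *\<^sub>v p v + ?t) $ k" using k by simp
    qed
    moreover have "?S \<in> carrier_mat d d" "?t \<in> carrier_vec d" by simp_all
    ultimately show "trivial_motion d (graph_of \<Delta>) p q"
      unfolding graph_of_def vert by (simp only: trivial_motion.simps) blast
  qed
  ultimately show ?thesis unfolding sparse_rigid_def assms(2) by blast
qed

end
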